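(* Let $p(n)\to\infty$ as $n\to\infty$, with $p(n)=o(n^\gamma)$ for some $\gamma>0$. Let $0<s<1$ and assume that for all $n\in\mathbb{N}$ the covariance matrix $\Sigma(n)$ is identical to the identity matrix except for some pair $(a,b)\in\Gamma(n)\times\Gamma(n)$ of distinct nodes, for which $\Sigma_{ab}(n)=\Sigma_{ba}(n)=s$. Then the probability of selecting the wrong neighborhood for node $a$ converges to $1$ under the prediction-oracle penalty: $$P(\hat{\mathrm{ne}}_a^{\lambda_{\mathrm{oracle}}}\ne\mathrm{ne}_a)\to1\qquad\text{as }n\to\infty.$$
   Context: For each $n\in\mathbb{N}$ let $\Gamma(n)=\{1,\dots,p(n)\}$ be a finite set of nodes and let $X=(X_k)_{k\in\Gamma(n)}\sim\mathcal{N}(0,\Sigma(n))$. $\mathbf{X}$ is the $n\times p(n)$ random matrix whose rows are $n$ independent observations of $X$; $\mathbf{X}_a\in\mathbb{R}^n$ is its column for node $a$; $\|\cdot\|_2$ is the Euclidean norm on $\mathbb{R}^n$, and $\|\theta\|_1=\sum_{b\in\Gamma(n)}|\theta_b|$. The neighborhood $\mathrm{ne}_a$ is the set of nodes $b\in\Gamma(n)\setminus\{a\}$ such that $X_a$ and $X_b$ are conditionally dependent given all remaining variables (equivalently $(\Sigma^{-1}(n))_{ab}\neq0$). Lasso: $\hat\theta^{a,\lambda}$ is a minimizer of $n^{-1}\|\mathbf{X}_a-\mathbf{X}\theta\|_2^2+\lambda\|\theta\|_1$ over $\theta\in\mathbb{R}^{p(n)}$ with $\theta_a=0$, where $\lambda\ge0$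 is the penalty parameter, and $\hat{\mathrm{ne}}_a^{\lambda}=\{b\in\Gamma(n):\hat\theta_b^{a,\lambda}\ne0\}$. Prediction-oracle penalty: $\lambda_{\mathrm{oracle}}=\arg\min_\lambda E\bigl(X_a-\sum_{k\in\Gamma(n)}\hat\theta_k^{a,\lambda}X_k\bigr)^2$, where the expectation is with respect to a new $X\sim\mathcal{N}(0,\Sigma(n))$ independent of the sample $\mathbf{X}$ on which $\hat\theta^{a,\lambda}$ is estimated (so the expectation is taken with $\mathbf{X}$, hence $\hat\theta^{a,\lambda}$, held fixed, and $\lambda_{\mathrm{oracle}}$ depends on the sample). *)

theory Defs
  imports
    "HOL-Probability.Probability"
    "HOL-Library.Landau_Symbols"
    "Jordan_Normal_Form.Determinant"
    "Jordan_Normal_Form.Gauss_Jordan_Elimination"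
begin

text \<open>Nodes are \<open>{1..p}\<close>. Vectors indexed by the nodes are functions \<open>nat \<Rightarrow> real\<close> of which only
  the values on \<open>{1..p}\<close> matter; matrices over the nodes are functions of two node arguments.
  \<open>node_mat\<close> shifts to the 0-based matrices of the matrix library.\<close>

definition node_mat :: "nat \<Rightarrow> (nat \<Rightarrow> nat \<Rightarrow> real) \<Rightarrow> real mat" where
  "node_mat p S = Matrix.mat p p (\<lambda>(i, j). S (Suc i) (Suc j))"

definition node_vec :: "nat \<Rightarrow> (nat \<Rightarrow> real) \<Rightarrow> real vec" where
  "node_vec p x = Matrix.vec p (\<lambda>i. x (Suc i))"

text \<open>The centred Gaussian law with covariance \<open>S\<close>, given by its density
  \<open>exp (- x\<^sup>T S\<^sup>-\<^sup>1 x / 2) / sqrt ((2 * pi) ^ p * det S)\<close>. Only meaningful for symmetric positive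
  definite \<open>S\<close>; in particular \<open>S\<close> has to be invertible, so that \<open>mat_inverse\<close> is not \<open>None\<close>.\<close>

definition mvn_density :: "nat \<Rightarrow> (nat \<Rightarrow> nat \<Rightarrow> real) \<Rightarrow> (nat \<Rightarrow> real) \<Rightarrow> real" where
  "mvn_density p S x =
     exp (- scalar_prod (node_vec p x)
              (mult_mat_vec (the (mat_inverse (node_mat p S))) (node_vec p x)) / 2)
     / sqrt ((2 * pi) ^ p * Determinant.det (node_mat p S))"

definition mvn :: "nat \<Rightarrow> (nat \<Rightarrow> nat \<Rightarrow> real) \<Rightarrow> (nat \<Rightarrow> real) measure" where
  "mvn p S = density (Pi\<^sub>M {1..p} (\<lambda>_. lborel)) (\<lambda>x. ennreal (mvn_density p S x))"

text \<open>\<open>X \<omega> i k\<close> is the entry in row (observation) \<open>i\<close> and column (node) \<open>k\<close> of the random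
  \<open>n \<times> p\<close> matrix.\<close>

definition mvn_sample ::
  "'w measure \<Rightarrow> nat \<Rightarrow> nat \<Rightarrow> (nat \<Rightarrow> nat \<Rightarrow> real) \<Rightarrow> ('w \<Rightarrow> nat \<Rightarrow> nat \<Rightarrow> real) \<Rightarrow> bool" where
  "mvn_sample M n p S X \<longleftrightarrow>
     prob_space M \<and>
     prob_space.indep_vars M (\<lambda>_. Pi\<^sub>M {1..p} (\<lambda>_. borel))
       (\<lambda>i \<omega>. restrict (X \<omega> i) {1..p}) {1..n} \<and>
     (\<forall>i\<in>{1..n}. distr M (mvn p S) (\<lambda>\<omega>. restrict (X \<omega> i) {1..p}) = mvn p S)"

definition cond_indep_rv ::
  "'w measure \<Rightarrow> 'w measure \<Rightarrow> ('w \<Rightarrow> real) \<Rightarrow> ('w \<Rightarrow> real) \<Rightarrow> bool" where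
  "cond_indep_rv M F Y Z \<longleftrightarrow>
     (\<forall>A\<in>sets borel. \<forall>B\<in>sets borel. AE \<omega> in M.
        real_cond_exp M F (\<lambda>\<omega>. indicator A (Y \<omega>) * indicator B (Z \<omega>)) \<omega> =
        real_cond_exp M F (\<lambda>\<omega>. indicator A (Y \<omega>)) \<omega> *
        real_cond_exp M F (\<lambda>\<omega>. indicator B (Z \<omega>)) \<omega>)"

text \<open>The sigma-algebra on the space of a measure \<open>N\<close> on node-indexed vectors that is generated by
  the coordinates in \<open>J\<close>.\<close>

definition coord_algebra :: "(nat \<Rightarrow> real) measure \<Rightarrow> nat set \<Rightarrow> (nat \<Rightarrow> real) measure" where
  "coord_algebra N J =
     vimage_algebra (space N) (\<lambda>x. restrict x J) (Pi\<^sub>M J (\<lambda>_. borel))"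

definition neighborhood :: "nat \<Rightarrow> (nat \<Rightarrow> nat \<Rightarrow> real) \<Rightarrow> nat \<Rightarrow> nat set" where
  "neighborhood p S a =
     {b \<in> {1..p} - {a}.
        \<not> cond_indep_rv (mvn p S) (coord_algebra (mvn p S) ({1..p} - {a, b}))
            (\<lambda>x. x a) (\<lambda>x. x b)}"

definition lasso_objective ::
  "nat \<Rightarrow> nat \<Rightarrow> (nat \<Rightarrow> nat \<Rightarrow> real) \<Rightarrow> nat \<Rightarrow> real \<Rightarrow> (nat \<Rightarrow> real) \<Rightarrow> real" where
  "lasso_objective n p X a l \<theta> =
     (L2_set (\<lambda>i. X i a - (\<Sum>k\<in>{1..p}. X i k * \<theta> k)) {1..n})\<^sup>2 / real n
     + l * (\<Sum>k\<in>{1..p}. \<bar>\<theta> k\<bar>)"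

definition is_lasso ::
  "nat \<Rightarrow> nat \<Rightarrow> (nat \<Rightarrow> nat \<Rightarrow> real) \<Rightarrow> nat \<Rightarrow> real \<Rightarrow> (nat \<Rightarrow> real) \<Rightarrow> bool" where
  "is_lasso n p X a l \<theta> \<longleftrightarrow> is_arg_min (lasso_objective n p X a l) (\<lambda>\<theta>. \<theta> a = 0) \<theta>"

definition selected_neighborhood :: "nat \<Rightarrow> (nat \<Rightarrow> real) \<Rightarrow> nat set" where
  "selected_neighborhood p \<theta> = {b \<in> {1..p}. \<theta> b \<noteq> 0}"

definition prediction_risk ::
  "nat \<Rightarrow> (nat \<Rightarrow> nat \<Rightarrow> real) \<Rightarrow> nat \<Rightarrow> (nat \<Rightarrow> real) \<Rightarrow> real" where
  "prediction_risk p S a \<theta> = (\<integral>x. (x a - (\<Sum>k\<in>{1..p}. \<theta> k * x k))\<^sup>2 \<partial>mvn p S)"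

text \<open>\<open>\<theta> l\<close> is the Lasso estimate for penalty \<open>l\<close>.\<close>

definition is_oracle_penalty ::
  "nat \<Rightarrow> (nat \<Rightarrow> nat \<Rightarrow> real) \<Rightarrow> nat \<Rightarrow> (real \<Rightarrow> nat \<Rightarrow> real) \<Rightarrow> real \<Rightarrow> bool" where
  "is_oracle_penalty p S a \<theta> l \<longleftrightarrow>
     is_arg_min (\<lambda>l. prediction_risk p S a (\<theta> l)) (\<lambda>l. l \<ge> 0) l"

end

theory Submission
  imports Defs "HOL-Real_Asymp.Real_Asymp"
begin

text \<open>
  The node \<open>a\<close> depends on the other nodes only through \<open>X\<^sub>a = s X\<^sub>b + W\<close>, where \<open>W\<close> and the \<open>X\<^sub>k\<close> with \<open>k \<noteq> a\<close>
  are independent normal variables. Write \<open>z\<close>, \<open>w\<close> and \<open>x\<^sub>k\<close> for the data columns of node \<open>b\<close>, of \<open>W\<close> and of a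
  remaining node \<open>k\<close>, and \<open>\<langle>u, v\<rangle>\<close> for the sum of \<open>u\<^sub>i v\<^sub>i\<close> over the observations. The neighborhood of \<open>a\<close> is
  \<open>{b}\<close> (lemma \<open>neighborhood_pair\<close>), and the risk of a coefficient vector \<open>\<theta>\<close> is
  \<open>1 - s\<^sup>2 + (\<theta>\<^sub>b - s)\<^sup>2 + \<Sum>\<theta>\<^sub>k\<^sup>2\<close> (lemma \<open>prediction_risk_pair\<close>). So it has to be shown that the oracle hardly
  ever selects exactly \<open>b\<close>.

  The core is deterministic (lemma \<open>oracle_not_single\<close>). If exactly \<open>b\<close> is selected, with coefficient
  \<open>\<theta>\<^sub>b = s + t\<close>, the residual is \<open>w - t z\<close>, and with \<open>\<kappa> = n \<lambda> / 2\<close> the optimality conditions of the Lasso say that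
  \<open>\<langle>z, w - t z\<rangle> = \<plusminus>\<kappa>\<close> and \<open>\<bar>\<langle>x\<^sub>k, w - t z\<rangle>\<bar> \<le> \<kappa>\<close>. Suppose that no column is aligned with \<open>z\<close>, meaning
  \<open>\<bar>\<langle>x\<^sub>k, z\<rangle>\<bar> < \<langle>z, z\<rangle>\<close> and \<open>\<bar>\<langle>x\<^sub>k, z\<rangle>\<bar> < \<langle>x\<^sub>k, x\<^sub>k\<rangle>\<close>, and that some column has a larger inner product with \<open>w\<close>
  than \<open>z\<close> has and some column a smaller one. Then \<open>\<theta>\<^sub>b > 0\<close> and \<open>t < 0\<close>: another variable enters
  before the coefficient of \<open>b\<close> has grown to \<open>s\<close>. When the penalty is lowered by a small amount, the
  coefficient of \<open>b\<close> grows at a positive rate and at most one other coefficient becomes nonzero, at a linear rate.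
  The gain in \<open>(\<theta>\<^sub>b - s)\<^sup>2\<close> is of first order and the loss in \<open>\<theta>\<^sub>k\<^sup>2\<close> of second order, so the penalty was not
  optimal for prediction.

  It remains to see that the data have these properties with probability tending to one (lemma
  \<open>prob_not_good_design_le\<close>). Alignment with \<open>z\<close> has probability at most \<open>4 p 2\<^sup>-\<^sup>n\<^sup>/\<^sup>2\<close> by Chernoff's bound, since
  \<open>E exp (\<plusminus>X Z - X\<^sup>2) = 1 / sqrt 2\<close> for independent standard normal \<open>X\<close> and \<open>Z\<close>; this tends to zero because \<open>p\<close>
  grows polynomially. The columns \<open>z\<close> and \<open>x\<^sub>k\<close> are exchangeable given \<open>w\<close>, so \<open>\<langle>z, w\<rangle>\<close> is the largest or the smallest of
  the \<open>p - 1\<close> inner products with probability at most \<open>2 / (p - 1)\<close>; this tends to zero because \<open>p\<close> tends to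
  infinity. That two further columns become active for the same penalty is an equation between the entries which is
  affine in one column, so it has probability zero.
\<close>

section \<open>Optimality and uniqueness of Lasso estimates\<close>

definition ip :: "nat \<Rightarrow> (nat \<Rightarrow> real) \<Rightarrow> (nat \<Rightarrow> real) \<Rightarrow> real" where
  "ip n u v = (\<Sum>i\<in>{1..n}. u i * v i)"

lemma ip_commute: "ip n u v = ip n v u"
  by (simp add: ip_def mult.commute)

lemma ip_nonneg: "0 \<le> ip n u u"
  by (simp add: ip_def sum_nonneg)

lemma ip_linear:
  "ip n (\<lambda>i. u i - v i) w = ip n u w - ip n v w"
  "ip n (\<lambda>i. u i + v i) w = ip n u w + ip n v w"
  "ip n (\<lambda>i. c * u i) w = c * ip n u w"
  "ip n (\<lambda>i. u i * c) w = c * ip n u w"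
  "ip n w (\<lambda>i. u i - v i) = ip n w u - ip n w v"
  "ip n w (\<lambda>i. u i + v i) = ip n w u + ip n w v"
  "ip n w (\<lambda>i. c * u i) = c * ip n w u"
  "ip n w (\<lambda>i. u i * c) = c * ip n w u"
  by (simp_all add: ip_def algebra_simps sum_subtractf sum.distrib sum_distrib_left)

lemma ip_sum: "ip n (\<lambda>i. \<Sum>k\<in>A. f i k * c k) w = (\<Sum>k\<in>A. c k * ip n (\<lambda>i. f i k) w)"
  unfolding ip_def sum_distrib_right sum_distrib_left
  by (subst sum.swap) (simp add: mult_ac)

definition resid :: "nat \<Rightarrow> (nat \<Rightarrow> nat \<Rightarrow> real) \<Rightarrow> nat \<Rightarrow> (nat \<Rightarrow> real) \<Rightarrow> nat \<Rightarrow> real" where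
  "resid p X a \<theta> i = X i a - (\<Sum>k\<in>{1..p}. X i k * \<theta> k)"

text \<open>The inner product of column \<open>k\<close> with the residual is, up to the factor \<open>- 2 / n\<close>, the partial
  derivative of the quadratic part of the Lasso objective.\<close>

definition resid_corr :: "nat \<Rightarrow> nat \<Rightarrow> (nat \<Rightarrow> nat \<Rightarrow> real) \<Rightarrow> nat \<Rightarrow> (nat \<Rightarrow> real) \<Rightarrow> nat \<Rightarrow> real" where
  "resid_corr n p X a \<theta> k = ip n (\<lambda>i. X i k) (resid p X a \<theta>)"

definition design_apply :: "nat \<Rightarrow> (nat \<Rightarrow> nat \<Rightarrow> real) \<Rightarrow> (nat \<Rightarrow> real) \<Rightarrow> nat \<Rightarrow> real" where
  "design_apply p X d i = (\<Sum>k\<in>{1..p}. X i k * d k)"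

lemma lasso_objective_scaled:
  assumes "n \<ge> 1"
  shows "n * lasso_objective n p X a l \<theta> =
    ip n (resid p X a \<theta>) (resid p X a \<theta>) + n * l * (\<Sum>k\<in>{1..p}. \<bar>\<theta> k\<bar>)"
proof -
  have "(L2_set (\<lambda>i. X i a - (\<Sum>k\<in>{1..p}. X i k * \<theta> k)) {1..n})\<^sup>2 =
      ip n (resid p X a \<theta>) (resid p X a \<theta>)"
    by (simp add: L2_set_def ip_def resid_def sum_nonneg power2_eq_square)
  then show ?thesis using assms by (simp add: lasso_objective_def algebra_simps)
qed

text \<open>The quadratic part of the objective is expanded around \<open>\<theta>\<close>; its first-order term joins the penalty
  coordinate by coordinate. Both optimality (a single coordinate is moved) and uniqueness (\<open>\<theta>\<close> satisfies
  the optimality conditions, so every summand of the first sum is nonnegative and the second sum vanishes)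
  are read off this identity. The scaling by \<open>n\<close> makes \<open>\<kappa> = n l / 2\<close> the natural threshold.\<close>

lemma lasso_gap:
  assumes "n \<ge> 1" and kap: "\<kappa> = n * l / 2"
  shows "n * (lasso_objective n p X a l \<theta>' - lasso_objective n p X a l \<theta>) =
     ip n (design_apply p X (\<lambda>k. \<theta>' k - \<theta> k)) (design_apply p X (\<lambda>k. \<theta>' k - \<theta> k))
     + 2 * (\<Sum>k\<in>{1..p}. \<kappa> * \<bar>\<theta>' k\<bar> - resid_corr n p X a \<theta> k * \<theta>' k)
     - 2 * (\<Sum>k\<in>{1..p}. \<kappa> * \<bar>\<theta> k\<bar> - resid_corr n p X a \<theta> k * \<theta> k)"
proof -
  define d where "d = (\<lambda>k. \<theta>' k - \<theta> k)"
  define r where "r = resid p X a \<theta>"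
  have r': "resid p X a \<theta>' = (\<lambda>i. r i - design_apply p X d i)"
    by (rule ext) (simp add: resid_def design_apply_def d_def r_def right_diff_distrib sum_subtractf)
  have "ip n (design_apply p X d) r = (\<Sum>k\<in>{1..p}. d k * resid_corr n p X a \<theta> k)"
    unfolding design_apply_def resid_corr_def r_def by (rule ip_sum)
  also have "\<dots> = (\<Sum>k\<in>{1..p}. resid_corr n p X a \<theta> k * \<theta>' k) - (\<Sum>k\<in>{1..p}. resid_corr n p X a \<theta> k * \<theta> k)"
    by (simp add: d_def algebra_simps sum_subtractf)
  finally have cross: "ip n (design_apply p X d) r = \<dots>" .
  have nl: "real n * l = 2 * \<kappa>" by (simp add: kap)
  have sq: "ip n (\<lambda>i. r i - design_apply p X d i) (\<lambda>i. r i - design_apply p X d i) =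
      ip n r r - 2 * ip n (design_apply p X d) r + ip n (design_apply p X d) (design_apply p X d)"
    by (simp only: ip_linear ip_commute[of n r "design_apply p X d"])
  have "n * (lasso_objective n p X a l \<theta>' - lasso_objective n p X a l \<theta>) =
     n * lasso_objective n p X a l \<theta>' - n * lasso_objective n p X a l \<theta>"
    by (rule right_diff_distrib)
  also have "\<dots> = ip n (design_apply p X d) (design_apply p X d) - 2 * ip n (design_apply p X d) r
       + 2 * (\<kappa> * (\<Sum>k\<in>{1..p}. \<bar>\<theta>' k\<bar>)) - 2 * (\<kappa> * (\<Sum>k\<in>{1..p}. \<bar>\<theta> k\<bar>))"
    unfolding lasso_objective_scaled[OF assms(1)] r' r_def[symmetric] sq nl by linarith
  finally show ?thesis
    unfolding cross d_def[symmetric] sum_subtractf sum_distrib_left[symmetric]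
    by argo
qed

lemma design_apply_single: "k \<in> {1..p} \<Longrightarrow> (\<And>j. j \<in> {1..p} \<Longrightarrow> j \<noteq> k \<Longrightarrow> d j = 0) \<Longrightarrow> design_apply p X d i = X i k * d k"
  unfolding design_apply_def by (subst sum.remove[of _ k]) (auto intro!: sum.neutral)

lemma design_apply_pair:
  assumes "b \<in> {1..p}" "k \<in> {1..p}" "b \<noteq> k" "\<And>j. j \<in> {1..p} \<Longrightarrow> j \<noteq> b \<Longrightarrow> j \<noteq> k \<Longrightarrow> d j = 0"
  shows "design_apply p X d i = X i b * d b + X i k * d k"
proof -
  have "design_apply p X d i = (\<Sum>j\<in>{b,k}. X i j * d j)"
    unfolding design_apply_def using assms by (intro sum.mono_neutral_right) auto
  then show ?thesis using assms by simp
qed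

text \<open>The next two facts are the one-dimensional first-order conditions, at the kink of the absolute value and
  away from it.\<close>

lemma quad_abs_bound:
  fixes q g \<kappa> :: real
  assumes "q \<ge> 0" and h: "\<And>t. 0 \<le> q * t\<^sup>2 + 2 * (\<kappa> * \<bar>t\<bar> - g * t)"
  shows "\<bar>g\<bar> \<le> \<kappa>"
proof (rule ccontr)
  assume not_le: "\<not> \<bar>g\<bar> \<le> \<kappa>"
  define m where "m = \<bar>g\<bar> - \<kappa>"
  have m: "m > 0" using not_le by (simp add: m_def)
  define t where "t = m / (q + 1)"
  have t: "t > 0" using m assms by (simp add: t_def)
  have "0 \<le> q * t\<^sup>2 - 2 * m * t"
    using h[of "if g < 0 then - t else t"] t
    by (auto simp: m_def algebra_simps abs_if split: if_splits)
  then have "0 \<le> t * (q * t - 2 * m)" by (simp add: power2_eq_square algebra_simps)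
  then have "2 * m \<le> q * t" using t by (simp add: zero_le_mult_iff)
  moreover have "q * t \<le> m" using assms m by (simp add: t_def field_simps)
  ultimately show False using m by simp
qed

lemma quad_linear_zero:
  fixes q m r :: real
  assumes "q \<ge> 0" "r > 0" and h: "\<And>t. \<bar>t\<bar> \<le> r \<Longrightarrow> 0 \<le> q * t\<^sup>2 + 2 * (t * m)"
  shows "m = 0"
proof (rule ccontr)
  assume m: "m \<noteq> 0"
  define u where "u = min (r / \<bar>m\<bar>) (1 / (q + 1))"
  have u: "u > 0" "u * \<bar>m\<bar> \<le> r" "u * q < 2"
  proof -
    show "u > 0" using assms m by (simp add: u_def)
    have "u * \<bar>m\<bar> \<le> r / \<bar>m\<bar> * \<bar>m\<bar>" by (rule mult_right_mono) (auto simp: u_def)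
    then show "u * \<bar>m\<bar> \<le> r" using m by simp
    have "u * q \<le> 1 / (q + 1) * q" by (rule mult_right_mono) (use assms in \<open>auto simp: u_def\<close>)
    also have "\<dots> < 2" using assms by (simp add: field_simps)
    finally show "u * q < 2" .
  qed
  have "0 \<le> q * (- (u * m))\<^sup>2 + 2 * (- (u * m) * m)"
    by (rule h) (use u in \<open>simp add: abs_mult\<close>)
  then have "0 \<le> u * m\<^sup>2 * (q * u - 2)" by (simp add: power2_eq_square algebra_simps)
  moreover have "0 < u * m\<^sup>2" using u m by simp
  moreover have "q * u - 2 < 0" using u(3) by (simp add: mult.commute)
  ultimately show False using mult_pos_neg by (metis not_less)
qed

lemma lasso_kkt:
  assumes n: "n \<ge> 1" and kap: "\<kappa> = n * l / 2"
    and L: "is_lasso n p X a l \<theta>" and k: "k \<in> {1..p}" "k \<noteq> a"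
  shows "\<theta> k = 0 \<Longrightarrow> \<bar>resid_corr n p X a \<theta> k\<bar> \<le> \<kappa>"
    and "\<theta> k \<noteq> 0 \<Longrightarrow> resid_corr n p X a \<theta> k = \<kappa> * sgn (\<theta> k)"
proof -
  define q where "q = ip n (\<lambda>i. X i k) (\<lambda>i. X i k)"
  define g where "g = resid_corr n p X a \<theta> k"
  have q0: "q \<ge> 0" by (simp add: q_def ip_nonneg)
  have key: "0 \<le> q * t\<^sup>2 + 2 * ((\<kappa> * \<bar>\<theta> k + t\<bar> - g * (\<theta> k + t)) - (\<kappa> * \<bar>\<theta> k\<bar> - g * \<theta> k))" for t
  proof -
    define \<theta>' where "\<theta>' = \<theta>(k := \<theta> k + t)"
    have "\<theta> a = 0" and min: "\<not> lasso_objective n p X a l \<theta>' < lasso_objective n p X a l \<theta>"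
      using L k unfolding is_lasso_def is_arg_min_def by (auto simp: \<theta>'_def)
    have "design_apply p X (\<lambda>j. \<theta>' j - \<theta> j) = (\<lambda>i. X i k * t)"
      by (rule ext, subst design_apply_single[OF k(1)]) (auto simp: \<theta>'_def)
    then have q: "ip n (design_apply p X (\<lambda>j. \<theta>' j - \<theta> j)) (design_apply p X (\<lambda>j. \<theta>' j - \<theta> j)) = q * t\<^sup>2"
      by (simp add: ip_linear q_def power2_eq_square)
    have "0 \<le> n * (lasso_objective n p X a l \<theta>' - lasso_objective n p X a l \<theta>)"
      using min n by simp
    also have "\<dots> = q * t\<^sup>2 + 2 * ((\<Sum>j\<in>{1..p}. \<kappa> * \<bar>\<theta>' j\<bar> - resid_corr n p X a \<theta> j * \<theta>' j)
        - (\<Sum>j\<in>{1..p}. \<kappa> * \<bar>\<theta> j\<bar> - resid_corr n p X a \<theta> j * \<theta> j))"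
      unfolding lasso_gap[OF n kap] q by simp
    also have "(\<Sum>j\<in>{1..p}. \<kappa> * \<bar>\<theta>' j\<bar> - resid_corr n p X a \<theta> j * \<theta>' j)
        - (\<Sum>j\<in>{1..p}. \<kappa> * \<bar>\<theta> j\<bar> - resid_corr n p X a \<theta> j * \<theta> j) =
       (\<kappa> * \<bar>\<theta> k + t\<bar> - g * (\<theta> k + t)) - (\<kappa> * \<bar>\<theta> k\<bar> - g * \<theta> k)"
      using k(1) by (simp add: sum.remove[of _ k] \<theta>'_def g_def)
    finally show ?thesis .
  qed
  show "\<bar>resid_corr n p X a \<theta> k\<bar> \<le> \<kappa>" if "\<theta> k = 0"
    using quad_abs_bound[OF q0, of \<kappa> g] key that by (simp add: g_def)
  show "resid_corr n p X a \<theta> k = \<kappa> * sgn (\<theta> k)" if nz: "\<theta> k \<noteq> 0"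
  proof -
    have "\<kappa> * sgn (\<theta> k) - g = 0"
    proof (rule quad_linear_zero[OF q0, of "\<bar>\<theta> k\<bar>"])
      fix t assume "\<bar>t\<bar> \<le> \<bar>\<theta> k\<bar>"
      then have "\<bar>\<theta> k + t\<bar> = \<bar>\<theta> k\<bar> + t * sgn (\<theta> k)"
        using nz by (auto simp: abs_if sgn_if split: if_splits)
      then show "0 \<le> q * t\<^sup>2 + 2 * (t * (\<kappa> * sgn (\<theta> k) - g))"
        using key[of t] by (simp add: algebra_simps)
    qed (use nz in auto)
    then show ?thesis by (simp add: g_def)
  qed
qed

text \<open>When \<open>\<theta>'\<close> satisfies the optimality conditions, all terms of the gap identity are nonnegative, so a
  minimizer \<open>\<theta>\<close> makes each of them vanish. This identifies the given estimates with explicitly constructed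
  ones, although minimizers need not be unique in general.\<close>

lemma lasso_unique_fit:
  assumes n: "n \<ge> 1" and kap: "\<kappa> = n * l / 2"
    and L: "is_lasso n p X a l \<theta>"
    and za: "\<theta>' a = 0"
    and feas: "\<And>k. k \<in> {1..p} \<Longrightarrow> k \<noteq> a \<Longrightarrow> \<bar>resid_corr n p X a \<theta>' k\<bar> \<le> \<kappa>"
    and compl: "\<And>k. k \<in> {1..p} \<Longrightarrow> k \<noteq> a \<Longrightarrow> resid_corr n p X a \<theta>' k * \<theta>' k = \<kappa> * \<bar>\<theta>' k\<bar>"
  shows "ip n (design_apply p X (\<lambda>k. \<theta> k - \<theta>' k)) (design_apply p X (\<lambda>k. \<theta> k - \<theta>' k)) = 0"
    and "\<And>k. k \<in> {1..p} \<Longrightarrow> k \<noteq> a \<Longrightarrow> \<bar>resid_corr n p X a \<theta>' k\<bar> < \<kappa> \<Longrightarrow> \<theta> k = 0"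
proof -
  let ?g = "resid_corr n p X a \<theta>'"
  let ?N = "ip n (design_apply p X (\<lambda>k. \<theta> k - \<theta>' k)) (design_apply p X (\<lambda>k. \<theta> k - \<theta>' k))"
  have \<theta>a: "\<theta> a = 0" and le: "lasso_objective n p X a l \<theta> \<le> lasso_objective n p X a l \<theta>'"
    using L za unfolding is_lasso_def is_arg_min_def by (auto simp: not_less[symmetric])
  have z: "(\<Sum>k\<in>{1..p}. \<kappa> * \<bar>\<theta>' k\<bar> - ?g k * \<theta>' k) = 0"
    by (rule sum.neutral) (use compl za in force)
  have nn: "0 \<le> \<kappa> * \<bar>\<theta> k\<bar> - ?g k * \<theta> k" if "k \<in> {1..p}" for k
  proof (cases "k = a")
    case False
    have "?g k * \<theta> k \<le> \<bar>?g k\<bar> * \<bar>\<theta> k\<bar>" by (metis abs_ge_self abs_mult)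
    also have "\<dots> \<le> \<kappa> * \<bar>\<theta> k\<bar>" using feas[OF that False] by (rule mult_right_mono) simp
    finally show ?thesis by simp
  qed (simp add: \<theta>a)
  let ?S = "\<Sum>k\<in>{1..p}. \<kappa> * \<bar>\<theta> k\<bar> - ?g k * \<theta> k"
  have "?N + 2 * ?S = n * (lasso_objective n p X a l \<theta> - lasso_objective n p X a l \<theta>')"
    unfolding lasso_gap[OF n kap, of p X a \<theta> \<theta>'] z by simp
  also have "\<dots> \<le> 0" using le by (simp add: mult_nonneg_nonpos)
  finally have "?N + 2 * ?S \<le> 0" .
  moreover have "0 \<le> ?N" by (rule ip_nonneg)
  moreover have "0 \<le> ?S" by (rule sum_nonneg) (use nn in auto)
  ultimately have N: "?N = 0" and S: "?S = 0" by linarith+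
  show "?N = 0" by (rule N)
  fix k assume k: "k \<in> {1..p}" "k \<noteq> a" "\<bar>?g k\<bar> < \<kappa>"
  have "\<kappa> * \<bar>\<theta> k\<bar> = ?g k * \<theta> k"
    using sum_nonneg_eq_0_iff[of "{1..p}" "\<lambda>k. \<kappa> * \<bar>\<theta> k\<bar> - ?g k * \<theta> k"] nn S k(1) by simp
  also have "\<dots> \<le> \<bar>?g k\<bar> * \<bar>\<theta> k\<bar>" by (metis abs_ge_self abs_mult)
  finally have "(\<kappa> - \<bar>?g k\<bar>) * \<bar>\<theta> k\<bar> \<le> 0" by (simp add: algebra_simps)
  then show "\<theta> k = 0" using k(3) by (simp add: mult_le_0_iff)
qed


section \<open>Designs for which the oracle overshoots\<close>

text \<open>\<open>U\<close> is the data matrix in which column \<open>a\<close> has been replaced by the noise \<open>w\<close> of the regression of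
  node \<open>a\<close> on node \<open>b\<close>. The first condition keeps the other columns from being aligned with column \<open>b\<close>, the
  next two say that column \<open>b\<close> is neither the most nor the least correlated with the noise, and the last
  one excludes that two other columns reach the threshold for the same penalty: it is the result of eliminating
  the residual coefficient \<open>t\<close> from \<open>\<langle>x\<^sub>j - \<eta> z, w - t z\<rangle> = 0 = \<langle>x\<^sub>k - \<epsilon> z, w - t z\<rangle>\<close>.\<close>

definition good_design :: "nat \<Rightarrow> nat set \<Rightarrow> nat \<Rightarrow> nat \<Rightarrow> (nat \<Rightarrow> nat \<Rightarrow> real) \<Rightarrow> bool" where
  "good_design n K a b U \<longleftrightarrow>
     (let c = (\<lambda>j k. ip n (\<lambda>i. U i j) (\<lambda>i. U i k)) in
     (\<forall>k\<in>K. \<bar>c k b\<bar> < c b b \<and> \<bar>c k b\<bar> < c k k) \<and>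
     (\<exists>k\<in>K. c k a > c b a) \<and> (\<exists>k\<in>K. c k a < c b a) \<and>
     (\<forall>j\<in>K. \<forall>k\<in>K. j \<noteq> k \<longrightarrow> (\<forall>\<eta>\<in>{-1,1}. \<forall>\<epsilon>\<in>{-1,1}.
        (c j a - \<eta> * c b a) * (c k b - \<epsilon> * c b b) \<noteq> (c k a - \<epsilon> * c b a) * (c j b - \<eta> * c b b))))"

text \<open>The Gram matrix of two columns is positive definite by diagonal dominance.\<close>

lemma pair_form_definite:
  fixes D F G x y :: real
  assumes "\<bar>G\<bar> < D" "\<bar>G\<bar> < F" and z: "x * (x * D) + x * (y * G) + (y * (x * G) + y * (y * F)) = 0"
  shows "x = 0 \<and> y = 0"
proof -
  have "x * (x * D) + x * (y * G) + (y * (x * G) + y * (y * F)) =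
      (D - \<bar>G\<bar>) * x\<^sup>2 + (F - \<bar>G\<bar>) * y\<^sup>2 + \<bar>G\<bar> * (x + sgn G * y)\<^sup>2"
    by (cases G "0::real" rule: linorder_cases) (auto simp: power2_eq_square algebra_simps)
  moreover have "0 \<le> (D - \<bar>G\<bar>) * x\<^sup>2" "0 \<le> (F - \<bar>G\<bar>) * y\<^sup>2" "0 \<le> \<bar>G\<bar> * (x + sgn G * y)\<^sup>2"
    using assms by auto
  ultimately have "(D - \<bar>G\<bar>) * x\<^sup>2 = 0" "(F - \<bar>G\<bar>) * y\<^sup>2 = 0" using z by linarith+
  then show ?thesis using assms by auto
qed

lemma risk_descent:
  fixes t e f :: real
  assumes "t < 0" "e > 0"
  shows "eventually (\<lambda>\<delta>. (t + \<delta> * e)\<^sup>2 + (\<delta> * f)\<^sup>2 < t\<^sup>2) (at_right 0)"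
proof -
  have "((\<lambda>\<delta>. 2 * t * e + \<delta> * (e\<^sup>2 + f\<^sup>2)) \<longlongrightarrow> 2 * t * e + 0 * (e\<^sup>2 + f\<^sup>2)) (at_right 0)"
    by (intro tendsto_intros)
  moreover have "2 * t * e + 0 * (e\<^sup>2 + f\<^sup>2) < 0" using assms by (simp add: mult_neg_pos)
  ultimately have "eventually (\<lambda>\<delta>. 2 * t * e + \<delta> * (e\<^sup>2 + f\<^sup>2) < 0) (at_right 0)"
    by (rule order_tendstoD)
  moreover have "eventually (\<lambda>\<delta>::real. \<delta> > 0) (at_right 0)"
    by (rule eventually_at_right_less)
  ultimately show ?thesis
  proof eventually_elim
    case (elim \<delta>)
    have "(t + \<delta> * e)\<^sup>2 + (\<delta> * f)\<^sup>2 = t\<^sup>2 + \<delta> * (2 * t * e + \<delta> * (e\<^sup>2 + f\<^sup>2))"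
      by (simp add: power2_eq_square algebra_simps)
    then show ?case using elim mult_pos_neg[of \<delta>] by fastforce
  qed
qed

lemma eventually_strict_slack:
  fixes g h \<kappa> :: real
  assumes "\<bar>g\<bar> < \<kappa>"
  shows "eventually (\<lambda>\<delta>. \<bar>g - \<delta> * h\<bar> < \<kappa> - \<delta>) (at_right 0)"
proof -
  have "((\<lambda>\<delta>. \<bar>g - \<delta> * h\<bar> - (\<kappa> - \<delta>)) \<longlongrightarrow> \<bar>g - 0 * h\<bar> - (\<kappa> - 0)) (at_right 0)"
    by (intro tendsto_intros)
  then have "eventually (\<lambda>\<delta>. \<bar>g - \<delta> * h\<bar> - (\<kappa> - \<delta>) < 0) (at_right 0)"
    by (rule order_tendstoD) (use assms in simp)
  then show ?thesis by (rule eventually_mono) simp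
qed

text \<open>If exactly \<open>b\<close> were selected, its coefficient \<open>s + t\<close> would still be too small (\<open>t < 0\<close>), because
  otherwise a column that is more correlated with the noise than column \<open>b\<close> would violate the optimality
  conditions. Lowering the penalty a little increases that coefficient at a positive linear rate, while at most
  one further coefficient enters, also linearly. So the error in coordinate \<open>b\<close> decreases to first order and the
  price for the new coordinate is of second order: a smaller penalty has smaller risk, which contradicts the
  choice of the oracle.\<close>

lemma oracle_not_single:
  fixes X :: "nat \<Rightarrow> nat \<Rightarrow> real" and \<theta> :: "real \<Rightarrow> nat \<Rightarrow> real"
  assumes n: "n \<ge> 1" and s: "0 \<le> s" and ab: "a \<in> {1..p}" "b \<in> {1..p}" "a \<noteq> b"
    and lasso: "\<And>l. l \<ge> 0 \<Longrightarrow> is_lasso n p X a l (\<theta> l)"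
    and risk: "\<And>\<theta>. \<theta> a = 0 \<Longrightarrow> prediction_risk p S a \<theta> =
        v + (\<theta> b - s)\<^sup>2 + (\<Sum>k\<in>{1..p} - {a, b}. (\<theta> k)\<^sup>2)"
    and orac: "is_oracle_penalty p S a \<theta> l"
    and good: "good_design n ({1..p} - {a, b}) a b (\<lambda>i. (X i)(a := X i a - s * X i b))"
  shows "selected_neighborhood p (\<theta> l) \<noteq> {b}"
proof
  assume sel: "selected_neighborhood p (\<theta> l) = {b}"
  define K where "K = {1..p} - {a, b}"
  define c where "c = (\<lambda>j k. ip n (\<lambda>i. X i j) (\<lambda>i. X i k))"
  define w where "w = (\<lambda>k. ip n (\<lambda>i. X i k) (\<lambda>i. X i a - s * X i b))"
  define \<kappa> where "\<kappa> = real n * l / 2"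
  define t where "t = \<theta> l b - s"
  define g where "g = resid_corr n p X a (\<theta> l)"
  have l0: "l \<ge> 0" using orac by (simp add: is_oracle_penalty_def is_arg_min_def)
  have \<kappa>0: "\<kappa> \<ge> 0" using l0 by (simp add: \<kappa>_def)
  have csym: "c j k = c k j" for j k by (simp add: c_def ip_commute)
  have Kne: "k \<noteq> a" "k \<noteq> b" "k \<in> {1..p}" if "k \<in> K" for k using that by (auto simp: K_def)

  define C where "C = (\<lambda>j k. ip n (\<lambda>i. ((X i)(a := X i a - s * X i b)) j)
      (\<lambda>i. ((X i)(a := X i a - s * X i b)) k))"
  have C: "j \<noteq> a \<Longrightarrow> k \<noteq> a \<Longrightarrow> C j k = c j k" "j \<noteq> a \<Longrightarrow> C j a = w j" for j k
    by (simp_all add: C_def c_def w_def)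
  have good': "\<forall>k\<in>K. \<bar>C k b\<bar> < C b b \<and> \<bar>C k b\<bar> < C k k"
    "\<exists>k\<in>K. C k a > C b a" "\<exists>k\<in>K. C k a < C b a"
    "\<forall>j\<in>K. \<forall>k\<in>K. j \<noteq> k \<longrightarrow> (\<forall>\<eta>\<in>{-1,1}. \<forall>\<epsilon>\<in>{-1,1}.
        (C j a - \<eta> * C b a) * (C k b - \<epsilon> * C b b) \<noteq> (C k a - \<epsilon> * C b a) * (C j b - \<eta> * C b b))"
    using good unfolding good_design_def Let_def K_def[symmetric] C_def by blast+
  have G1: "\<bar>c k b\<bar> < c b b" "\<bar>c k b\<bar> < c k k" if "k \<in> K" for k
    using good'(1) that Kne[OF that] ab by (auto simp: C)
  obtain k1 where k1: "k1 \<in> K" "w k1 > w b"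
    using good'(2) ab(3) by (auto simp: C Kne)
  obtain k2 where k2: "k2 \<in> K" "w k2 < w b"
    using good'(3) ab(3) by (auto simp: C Kne)
  have G3: "(w j - \<eta> * w b) * (c k b - \<epsilon> * c b b) \<noteq> (w k - \<epsilon> * w b) * (c j b - \<eta> * c b b)"
    if "j \<in> K" "k \<in> K" "j \<noteq> k" "\<eta> \<in> {-1,1}" "\<epsilon> \<in> {-1,1}" for j k \<eta> \<epsilon>
    using good'(4)[rule_format, OF that] Kne[OF that(1)] Kne[OF that(2)] ab(3) by (simp add: C)

  have \<theta>a: "\<theta> l a = 0" if "l \<ge> 0" for l
    using lasso[OF that] by (simp add: is_lasso_def is_arg_min_def)
  have \<theta>b: "\<theta> l b \<noteq> 0" using sel by (auto simp: selected_neighborhood_def)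
  have \<theta>0: "\<theta> l k = 0" if "k \<in> {1..p}" "k \<noteq> b" for k
    using sel that by (auto simp: selected_neighborhood_def)
  have res: "resid p X a (\<theta> l) = (\<lambda>i. (X i a - s * X i b) - t * X i b)"
    by (rule ext, unfold resid_def design_apply_def[symmetric], subst design_apply_single[of b])
       (use ab \<theta>0 in \<open>auto simp: t_def algebra_simps\<close>)
  have g_eq: "g k = w k - t * c k b" for k
    unfolding g_def resid_corr_def res by (simp only: ip_linear(5,7) w_def c_def)
  have gb: "g b = \<kappa> * sgn (\<theta> l b)"
    using lasso_kkt(2)[OF n \<kappa>_def lasso[OF l0] ab(2)] ab \<theta>b by (auto simp: g_def)
  have gK: "\<bar>g k\<bar> \<le> \<kappa>" if "k \<in> K" for k
    using lasso_kkt(1)[OF n \<kappa>_def lasso[OF l0], of k] Kne[OF that] \<theta>0 by (auto simp: g_def)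

  \<comment> \<open>Two ties would give two linear equations for the single unknown \<open>t\<close>, which the last condition excludes.\<close>
  have no_two_ties: "\<bar>g k\<bar> < \<kappa>" if jk: "j \<in> K" "k \<in> K" "j \<noteq> k" and tie: "\<bar>g j\<bar> = \<kappa>" for j k
  proof (rule ccontr)
    assume "\<not> \<bar>g k\<bar> < \<kappa>"
    then have gk: "\<bar>g k\<bar> = \<kappa>" using gK jk by force
    have gb': "\<bar>g b\<bar> = \<kappa>" using gb \<theta>b \<kappa>0 by (simp add: abs_mult abs_sgn_eq)
    have signs: "\<exists>\<eta>\<in>{-1,1::real}. x = \<eta> * g b" if "\<bar>x\<bar> = \<bar>g b\<bar>" for x
      using that by (auto simp: abs_eq_iff)
    have "\<exists>\<eta>\<in>{-1,1::real}. g j = \<eta> * g b" using signs[of "g j"] tie gb' by simp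
    then obtain \<eta> where \<eta>: "\<eta> \<in> {-1,1::real}" "g j = \<eta> * g b" by blast
    have "\<exists>\<epsilon>\<in>{-1,1::real}. g k = \<epsilon> * g b" using signs[of "g k"] gk gb' by simp
    then obtain \<epsilon> where \<epsilon>: "\<epsilon> \<in> {-1,1::real}" "g k = \<epsilon> * g b" by blast
    have "w j - \<eta> * w b = t * (c j b - \<eta> * c b b)" "w k - \<epsilon> * w b = t * (c k b - \<epsilon> * c b b)"
      using \<eta>(2) \<epsilon>(2) unfolding g_eq by (simp_all add: algebra_simps)
    then show False using G3[OF jk \<eta>(1) \<epsilon>(1)] by simp
  qed
  have \<kappa>pos: "\<kappa> > 0"
  proof (rule ccontr)
    assume "\<not> \<kappa> > 0"
    then have "\<bar>g k1\<bar> = \<kappa>" using gK[OF k1(1)] \<kappa>0 by simp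
    moreover have "k1 \<noteq> k2" using k1 k2 by auto
    ultimately have "\<bar>g k2\<bar> < \<kappa>" using no_two_ties[OF k1(1) k2(1)] by simp
    then show False using \<open>\<not> \<kappa> > 0\<close> by simp
  qed

  \<comment> \<open>For a negative coefficient the sign is reversed, and a column that is less correlated with the noise
    than column \<open>b\<close> exceeds the threshold.\<close>
  have pos: "\<theta> l b > 0"
  proof (rule ccontr)
    assume "\<not> \<theta> l b > 0"
    then have neg: "\<theta> l b < 0" using \<theta>b by simp
    then have gbn: "g b = - \<kappa>" using gb by simp
    have "t \<le> 0" using neg s by (simp add: t_def)
    then have "t * (c k2 b - c b b) \<ge> 0" using G1[OF k2(1)] by (intro mult_nonpos_nonpos) auto
    then have "g k2 < g b" using k2(2) by (simp add: g_eq algebra_simps)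
    then show False using gbn gK[OF k2(1)] by auto
  qed
  then have gbk: "g b = \<kappa>" using gb by simp
  \<comment> \<open>Subtract the condition at \<open>b\<close> from the one at \<open>k1\<close>: \<open>g k1 - g b = (w k1 - w b) - t (c k1 b - c b b)\<close>,
    which is positive for \<open>t \<ge> 0\<close>.\<close>
  have t0: "t < 0"
  proof (rule ccontr)
    assume "\<not> t < 0"
    then have "t * (c k1 b - c b b) \<le> 0" using G1[OF k1(1)] by (intro mult_nonneg_nonpos) auto
    then have "g k1 > g b" using k1(2) by (simp add: g_eq algebra_simps)
    then show False using gbk gK[OF k1(1)] by auto
  qed

  \<comment> \<open>The only column that can enter next; if none is tied, any column will do.\<close>
  obtain k where k: "k \<in> K" and strict: "\<And>j. j \<in> K \<Longrightarrow> j \<noteq> k \<Longrightarrow> \<bar>g j\<bar> < \<kappa>"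
  proof (cases "\<exists>k\<in>K. \<bar>g k\<bar> = \<kappa>")
    case True
    then show ?thesis using that no_two_ties by metis
  next
    case False
    then have "\<bar>g j\<bar> < \<kappa>" if "j \<in> K" for j using gK[OF that] that by force
    then show ?thesis using that k1(1) by blast
  qed
  define D where "D = c b b"
  define F where "F = c k k"
  define G where "G = c k b"
  have DFG: "\<bar>G\<bar> < D" "\<bar>G\<bar> < F" using G1[OF k] by (simp_all add: D_def F_def G_def)
  \<comment> \<open>\<open>(e, f)\<close> is the velocity of the coefficients of \<open>b\<close> and \<open>k\<close> as \<open>\<kappa>\<close> decreases: it solves the
    normal equations of these two columns with right-hand side \<open>(1, \<eta>)\<close> if \<open>k\<close> is tied with sign \<open>\<eta>\<close>.\<close>
  obtain e f where e: "e > 0" "D * e + G * f = 1"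
    and f: "(f = 0 \<and> \<bar>g k\<bar> < \<kappa>) \<or>
      (\<exists>\<eta>\<in>{-1,1}. g k = \<eta> * \<kappa> \<and> G * e + F * f = \<eta> \<and> \<eta> * f \<ge> 0)"
  proof (cases "\<bar>g k\<bar> < \<kappa>")
    case True
    show ?thesis by (rule that[of "1 / D" 0]) (use DFG True in auto)
  next
    case False
    define \<eta> where "\<eta> = sgn (g k)"
    have ge: "\<bar>g k\<bar> = \<kappa>" using False gK[OF k] by simp
    have \<eta>: "\<eta> \<in> {-1,1}" "g k = \<eta> * \<kappa>" "\<eta> * \<eta> = 1"
      using ge \<kappa>pos by (auto simp: \<eta>_def sgn_if)
    have \<eta>G: "\<eta> * G \<le> \<bar>G\<bar>" using \<eta>(1) by auto
    define d where "d = D * F - G * G"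
    have "\<bar>G\<bar> * \<bar>G\<bar> < D * F" using DFG by (intro mult_strict_mono) auto
    then have d: "d > 0" by (simp add: d_def)
    show ?thesis
    proof (rule that[of "(F - \<eta> * G) / d" "\<eta> * (D - \<eta> * G) / d"])
      show "(F - \<eta> * G) / d > 0" using d \<eta>G DFG by simp
      have "D * (F - \<eta> * G) + G * (\<eta> * (D - \<eta> * G)) = D * F - (\<eta> * \<eta>) * (G * G)"
        by (simp add: algebra_simps)
      then show "D * ((F - \<eta> * G) / d) + G * (\<eta> * (D - \<eta> * G) / d) = 1"
        using d \<eta>(3) by (simp add: d_def add_divide_distrib[symmetric])
      have "G * (F - \<eta> * G) + F * (\<eta> * (D - \<eta> * G)) = \<eta> * d"
        using \<eta>(1) by (auto simp: d_def algebra_simps)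
      then have 1: "G * ((F - \<eta> * G) / d) + F * (\<eta> * (D - \<eta> * G) / d) = \<eta>"
        using d by (simp add: add_divide_distrib[symmetric])
      have "\<eta> * (\<eta> * (D - \<eta> * G) / d) = (\<eta> * \<eta>) * ((D - \<eta> * G) / d)" by simp
      also have "\<dots> \<ge> 0" using \<eta>(3) d \<eta>G DFG by simp
      finally have 2: "\<eta> * (\<eta> * (D - \<eta> * G) / d) \<ge> 0" .
      show "(\<eta> * (D - \<eta> * G) / d = 0 \<and> \<bar>g k\<bar> < \<kappa>) \<or>
        (\<exists>\<eta>'\<in>{-1,1}. g k = \<eta>' * \<kappa> \<and>
          G * ((F - \<eta> * G) / d) + F * (\<eta> * (D - \<eta> * G) / d) = \<eta>' \<and>
          \<eta>' * (\<eta> * (D - \<eta> * G) / d) \<ge> 0)"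
        using \<eta>(1,2) 1 2 by blast
    qed
  qed
  have kab: "k \<noteq> a" "k \<noteq> b" "k \<in> {1..p}" using Kne[OF k] by auto

  define h where "h = (\<lambda>j. c j b * e + c j k * f)"
  have "eventually (\<lambda>\<delta>. \<forall>j\<in>{j\<in>K. \<bar>g j\<bar> < \<kappa>}. \<bar>g j - \<delta> * h j\<bar> < \<kappa> - \<delta>) (at_right 0)"
    by (intro eventually_ball_finite ballI eventually_strict_slack) (auto simp: K_def)
  moreover have "eventually (\<lambda>\<delta>::real. \<delta> \<in> {0<..<\<kappa>}) (at_right 0)"
    by (rule eventually_at_right_real[OF \<kappa>pos])
  ultimately have "eventually (\<lambda>\<delta>. ((t + \<delta> * e)\<^sup>2 + (\<delta> * f)\<^sup>2 < t\<^sup>2 \<and> \<delta> \<in> {0<..<\<kappa>}) \<and>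
      (\<forall>j\<in>{j\<in>K. \<bar>g j\<bar> < \<kappa>}. \<bar>g j - \<delta> * h j\<bar> < \<kappa> - \<delta>)) (at_right 0)"
    using risk_descent[OF t0 e(1), of f] by eventually_elim blast
  then obtain \<delta> where \<delta>: "(t + \<delta> * e)\<^sup>2 + (\<delta> * f)\<^sup>2 < t\<^sup>2" "0 < \<delta>" "\<delta> < \<kappa>"
    and slack: "\<And>j. j \<in> K \<Longrightarrow> \<bar>g j\<bar> < \<kappa> \<Longrightarrow> \<bar>g j - \<delta> * h j\<bar> < \<kappa> - \<delta>"
    by (rule eventually_happens'[OF trivial_limit_at_right_real, THEN exE]) auto

  \<comment> \<open>The estimate for the lower penalty is \<open>\<theta> l + \<delta> (e, f)\<close>, by uniqueness.\<close>
  define l' where "l' = 2 * (\<kappa> - \<delta>) / n"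
  have l': "l' \<ge> 0" "\<kappa> - \<delta> = real n * l' / 2" using \<delta> n by (simp_all add: l'_def)
  define \<theta>' where "\<theta>' = (\<lambda>j. if j = b then \<theta> l b + \<delta> * e else if j = k then \<delta> * f else 0)"
  have move: "design_apply p X (\<lambda>j. \<theta>' j - \<theta> l j) = (\<lambda>i. \<delta> * (X i b * e) + \<delta> * (X i k * f))"
    by (rule ext, subst design_apply_pair[OF ab(2) kab(3)])
       (use kab \<theta>0 in \<open>auto simp: \<theta>'_def algebra_simps\<close>)
  have "resid p X a \<theta>' = (\<lambda>i. resid p X a (\<theta> l) i - design_apply p X (\<lambda>j. \<theta>' j - \<theta> l j) i)"
    by (rule ext) (simp add: resid_def design_apply_def right_diff_distrib sum_subtractf)
  then have g': "resid_corr n p X a \<theta>' j = g j - \<delta> * h j" for j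
    unfolding resid_corr_def g_def move h_def c_def
    by (simp add: ip_linear distrib_left algebra_simps)
  have hb: "h b = 1" using e(2) csym[of b k] by (simp add: h_def D_def G_def)
  have hk: "h k = G * e + F * f" by (simp add: h_def F_def G_def)
  have sp: "sgn (\<theta> l b + \<delta> * e) = 1" "\<bar>\<theta> l b + \<delta> * e\<bar> = \<theta> l b + \<delta> * e"
    using pos \<delta>(2) e(1) by (simp_all add: add_pos_pos)
  have k_tied: "\<bar>g k - \<delta> * h k\<bar> \<le> \<kappa> - \<delta> \<and> (g k - \<delta> * h k) * (\<delta> * f) = (\<kappa> - \<delta>) * \<bar>\<delta> * f\<bar>"
    using f
  proof
    assume "f = 0 \<and> \<bar>g k\<bar> < \<kappa>"
    then show ?thesis using slack[OF k] by simp
  next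
    assume "\<exists>\<eta>\<in>{-1,1}. g k = \<eta> * \<kappa> \<and> G * e + F * f = \<eta> \<and> \<eta> * f \<ge> 0"
    then obtain \<eta> where \<eta>: "\<eta> \<in> {-1,1}" "g k = \<eta> * \<kappa>" "h k = \<eta>" "\<eta> * f \<ge> 0"
      unfolding hk by blast
    have "g k - \<delta> * h k = \<eta> * (\<kappa> - \<delta>)" by (simp add: \<eta> algebra_simps)
    moreover have "\<bar>f\<bar> = \<eta> * f" using \<eta>(1,4) by auto
    ultimately show ?thesis using \<eta>(1) \<delta>(2,3) by (auto simp: abs_mult)
  qed
  have Kcases: "j = b \<or> j = k \<or> (j \<in> K \<and> j \<noteq> k)" if "j \<in> {1..p}" "j \<noteq> a" for j
    using that by (auto simp: K_def)
  have \<theta>'v: "\<theta>' b = \<theta> l b + \<delta> * e" "\<theta>' k = \<delta> * f" "\<theta>' a = 0"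
    "\<And>j. j \<in> K \<Longrightarrow> j \<noteq> k \<Longrightarrow> \<theta>' j = 0"
    using kab ab by (auto simp: \<theta>'_def K_def)
  have at_j: "\<bar>g j - \<delta> * h j\<bar> \<le> \<kappa> - \<delta> \<and> (g j - \<delta> * h j) * \<theta>' j = (\<kappa> - \<delta>) * \<bar>\<theta>' j\<bar>"
    if j: "j \<in> {1..p}" "j \<noteq> a" for j
    using Kcases[OF j]
  proof (elim disjE)
    assume "j = b"
    then show ?thesis using \<delta>(3) by (simp add: hb gbk \<theta>'v sp)
  next
    assume "j = k"
    then show ?thesis using k_tied by (simp add: \<theta>'v)
  next
    assume "j \<in> K \<and> j \<noteq> k"
    then show ?thesis using slack[OF _ strict, of j] by (simp add: \<theta>'v)
  qed
  have feas: "\<bar>resid_corr n p X a \<theta>' j\<bar> \<le> \<kappa> - \<delta>"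
    and compl: "resid_corr n p X a \<theta>' j * \<theta>' j = (\<kappa> - \<delta>) * \<bar>\<theta>' j\<bar>"
    if j: "j \<in> {1..p}" "j \<noteq> a" for j
    using at_j[OF j] unfolding g' by auto
  note uniq = lasso_unique_fit[OF n l'(2) lasso[OF l'(1)] \<theta>'v(3) feas compl]
  have off: "\<theta> l' j = 0" if "j \<in> K" "j \<noteq> k" for j
  proof (rule uniq(2))
    show "\<bar>resid_corr n p X a \<theta>' j\<bar> < \<kappa> - \<delta>"
      unfolding g' by (rule slack[OF that(1) strict[OF that]])
  qed (use Kne[OF that(1)] in auto)
  have fit: "ip n (design_apply p X (\<lambda>j. \<theta> l' j - \<theta>' j)) (design_apply p X (\<lambda>j. \<theta> l' j - \<theta>' j)) = 0"
    by (rule uniq(1))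
  define x where "x = \<theta> l' b - \<theta>' b"
  define y where "y = \<theta> l' k - \<theta>' k"
  have "design_apply p X (\<lambda>j. \<theta> l' j - \<theta>' j) = (\<lambda>i. X i b * x + X i k * y)"
  proof (rule ext, subst design_apply_pair[OF ab(2) kab(3)])
    fix j assume j: "j \<in> {1..p}" "j \<noteq> b" "j \<noteq> k"
    show "\<theta> l' j - \<theta>' j = 0"
      using j off[of j] \<theta>a[OF l'(1)] by (cases "j = a") (auto simp: \<theta>'_def K_def)
  qed (use kab in \<open>auto simp: x_def y_def\<close>)
  then have "ip n (\<lambda>i. X i b * x + X i k * y) (\<lambda>i. X i b * x + X i k * y) = 0"
    using fit by simp
  moreover have "ip n (\<lambda>i. X i b * x + X i k * y) (\<lambda>i. X i b * x + X i k * y) =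
      x * (x * D) + x * (y * G) + (y * (x * G) + y * (y * F))"
    unfolding D_def F_def G_def
    by (simp only: ip_linear(2,4,6,8) c_def distrib_left ip_commute[of n "\<lambda>i. X i b" "\<lambda>i. X i k"])
  ultimately have "x * (x * D) + x * (y * G) + (y * (x * G) + y * (y * F)) = 0"
    by (simp only:)
  then have xy: "x = 0" "y = 0" using pair_form_definite[OF DFG] by blast+
  have v1: "\<theta> l' b = \<theta> l b + \<delta> * e" "\<theta> l' k = \<delta> * f"
    using xy kab by (simp_all add: x_def y_def \<theta>'_def)
  have "(\<Sum>j\<in>K. (\<theta> l' j)\<^sup>2) = (\<delta> * f)\<^sup>2"
    using k off by (subst sum.remove[of _ k]) (auto simp: K_def v1)
  moreover have "(\<Sum>j\<in>K. (\<theta> l j)\<^sup>2) = 0"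
    by (rule sum.neutral) (use \<theta>0 Kne in auto)
  ultimately have "prediction_risk p S a (\<theta> l') < prediction_risk p S a (\<theta> l)"
    using \<delta>(1) unfolding risk[of "\<theta> l'", OF \<theta>a[OF l'(1)]] risk[of "\<theta> l", OF \<theta>a[OF l0]] K_def[symmetric] v1
    by (simp add: t_def algebra_simps)
  then show False using orac l'(1) by (simp add: is_oracle_penalty_def is_arg_min_def)
qed

section \<open>Resampling one coordinate of a product measure\<close>

text \<open>This form of Fubini's theorem needs no splitting of the index set: the coordinate \<open>i\<close> of the outer variable
  is overwritten, and integrating over it contributes a factor one. Moments, exponential moments,
  independence and null sets are all computed with it, one coordinate at a time.\<close>

lemma nn_integral_PiM_resample:
  assumes M: "\<And>i. prob_space (M i)" and I: "finite I" "i \<in> I"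
    and f: "f \<in> borel_measurable (PiM I M)"
  shows "(\<integral>\<^sup>+x. f x \<partial>PiM I M) = (\<integral>\<^sup>+x. (\<integral>\<^sup>+y. f (x(i := y)) \<partial>M i) \<partial>PiM I M)"
proof -
  interpret product_prob_space M I
    by (rule product_prob_spaceI) (rule M)
  define J where "J = I - {i}"
  have J: "finite J" "i \<notin> J" and IJ: "I = insert i J" using I by (auto simp: J_def)
  have f'[measurable]: "f \<in> borel_measurable (PiM (insert i J) M)" using f by (simp add: IJ)
  have upd: "(\<lambda>(x, y). x(i := y)) \<in> measurable (PiM (insert i J) M \<Otimes>\<^sub>M M i) (PiM (insert i J) M)"
    using measurable_add_dim[of i "insert i J" M] by simp
  have "(\<lambda>(x, y). f (x(i := y))) \<in> borel_measurable (PiM (insert i J) M \<Otimes>\<^sub>M M i)"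
    using measurable_comp[OF upd f'] by (simp add: comp_def case_prod_beta')
  then have g: "(\<lambda>x. \<integral>\<^sup>+y. f (x(i := y)) \<partial>M i) \<in> borel_measurable (PiM (insert i J) M)"
    by (intro M.borel_measurable_nn_integral) 
  have "(\<integral>\<^sup>+x. (\<integral>\<^sup>+y. f (x(i := y)) \<partial>M i) \<partial>PiM I M) =
      (\<integral>\<^sup>+x. (\<integral>\<^sup>+z. (\<integral>\<^sup>+y. f (x(i := y)) \<partial>M i) \<partial>M i) \<partial>PiM J M)"
    unfolding IJ by (subst product_nn_integral_insert[OF J g]) simp
  also have "\<dots> = (\<integral>\<^sup>+x. (\<integral>\<^sup>+y. f (x(i := y)) \<partial>M i) \<partial>PiM J M)"
    by (simp add: M.emeasure_space_1)
  also have "\<dots> = (\<integral>\<^sup>+x. f x \<partial>PiM I M)"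
    unfolding IJ by (rule product_nn_integral_insert[OF J f', symmetric])
  finally show ?thesis ..
qed

lemma measurable_PiM_upd:
  assumes "x \<in> space (PiM I M)" "i \<in> I"
  shows "(\<lambda>y. x(i := y)) \<in> measurable (M i) (PiM I M)"
  using measurable_fun_upd[of I "{i} \<union> I" i "\<lambda>_. x" "M i" M "\<lambda>y. y"] assms
  by (auto simp: insert_absorb)

lemma emeasure_PiM_resample:
  assumes M: "\<And>i. prob_space (M i)" and I: "finite I" "i \<in> I" and A: "A \<in> sets (PiM I M)"
  shows "emeasure (PiM I M) A =
    (\<integral>\<^sup>+x. emeasure (M i) {y \<in> space (M i). x(i := y) \<in> A} \<partial>PiM I M)"
proof -
  have "emeasure (PiM I M) A = (\<integral>\<^sup>+x. (\<integral>\<^sup>+y. indicator A (x(i := y)) \<partial>M i) \<partial>PiM I M)"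
    using A by (subst nn_integral_PiM_resample[OF M I, symmetric]) auto
  also have "\<dots> = (\<integral>\<^sup>+x. emeasure (M i) {y \<in> space (M i). x(i := y) \<in> A} \<partial>PiM I M)"
  proof (rule nn_integral_cong)
    fix x assume x: "x \<in> space (PiM I M)"
    have "(\<lambda>y. x(i := y)) \<in> measurable (M i) (PiM I M)"
      using x I(2) by (rule measurable_PiM_upd)
    then have "(\<lambda>y. x(i := y)) -` A \<inter> space (M i) \<in> sets (M i)"
      using A by (rule measurable_sets)
    also have "(\<lambda>y. x(i := y)) -` A \<inter> space (M i) = {y \<in> space (M i). x(i := y) \<in> A}" by auto
    finally have "{y \<in> space (M i). x(i := y) \<in> A} \<in> sets (M i)" .
    then show "(\<integral>\<^sup>+y. indicator A (x(i := y)) \<partial>M i) = emeasure (M i) {y \<in> space (M i). x(i := y) \<in> A}"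
      by (subst nn_integral_indicator[symmetric])
        (simp, intro nn_integral_cong, simp add: indicator_def)
  qed
  finally show ?thesis .
qed

lemma null_sets_PiM_slices:
  assumes M: "\<And>i. prob_space (M i)" and I: "finite I" "i \<in> I" and A: "A \<in> sets (PiM I M)"
    and "\<And>x. x \<in> space (PiM I M) \<Longrightarrow> emeasure (M i) {y \<in> space (M i). x(i := y) \<in> A} = 0"
  shows "emeasure (PiM I M) A = 0"
  unfolding emeasure_PiM_resample[OF M I A]
  using nn_integral_cong[of "PiM I M" "\<lambda>x. emeasure (M i) {y \<in> space (M i). x(i := y) \<in> A}" "\<lambda>_. 0"] assms(5)
  by simp

text \<open>The entry \<open>(i, k)\<close> of the random matrix is drawn independently of the other entries and without atoms, so
  it almost surely misses the only value that the other entries leave to it.\<close>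

lemma AE_PiM_PiM_unique_entry:
  fixes P :: "('i \<Rightarrow> 'k \<Rightarrow> 'a) \<Rightarrow> bool"
  assumes N: "\<And>k. prob_space (N k)" and fin: "finite I" "finite K" and ik: "i \<in> I" "k \<in> K"
    and atom: "\<And>z. z \<in> space (N k) \<Longrightarrow> {z} \<in> null_sets (N k)"
    and P: "{U \<in> space (PiM I (\<lambda>_. PiM K N)). P U} \<in> sets (PiM I (\<lambda>_. PiM K N))"
    and uniq: "\<And>U y z. P (U(i := (U i)(k := y))) \<Longrightarrow> P (U(i := (U i)(k := z))) \<Longrightarrow> y = z"
  shows "AE U in PiM I (\<lambda>_. PiM K N). \<not> P U"
proof -
  let ?R = "PiM K N" and ?Q = "PiM I (\<lambda>_. PiM K N)"
  let ?A = "{U \<in> space ?Q. P U}"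
  have R: "prob_space ?R" using N by (rule prob_space_PiM)
  have "emeasure ?Q ?A = 0"
  proof (rule null_sets_PiM_slices[OF R fin(1) ik(1) P])
    fix U assume U: "U \<in> space ?Q"
    have B: "{x \<in> space ?R. U(i := x) \<in> ?A} \<in> sets ?R"
      using measurable_sets[OF measurable_PiM_upd[OF U ik(1)] P]
      by (simp add: vimage_def Int_def conj_commute)
    show "emeasure ?R {x \<in> space ?R. U(i := x) \<in> ?A} = 0"
    proof (rule null_sets_PiM_slices[OF N fin(2) ik(2) B])
      fix x assume x: "x \<in> space ?R"
      let ?S = "{z \<in> space (N k). x(k := z) \<in> {x \<in> space ?R. U(i := x) \<in> ?A}}"
      show "emeasure (N k) ?S = 0"
      proof (cases "?S = {}")
        case False
        then obtain z where z: "z \<in> ?S" by blast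
        have "?S \<subseteq> {z}"
        proof
          fix y assume "y \<in> ?S"
          then show "y \<in> {z}"
            using z uniq[of "U(i := x)" y z] by auto
        qed
        then have "?S = {z}" using z by blast
        then have "emeasure (N k) ?S = emeasure (N k) {z}" by (simp only:)
        also have "\<dots> = 0" using atom[of z] z by (simp add: null_sets_def)
        finally show ?thesis .
      next
        case True
        show ?thesis unfolding True by simp
      qed
    qed
  qed
  then show ?thesis
    using P by (subst AE_iff_measurable[OF P]) auto
qed

text \<open>Chernoff's bound at exponent one.\<close>

lemma measure_PiM_sum_nonneg_le:
  assumes Q: "prob_space Q" and h[measurable]: "h \<in> borel_measurable Q" and "finite I"
    and \<rho>: "(\<integral>\<^sup>+x. ennreal (exp (h x)) \<partial>Q) = ennreal \<rho>" "\<rho> \<ge> 0"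
  shows "measure (PiM I (\<lambda>_. Q)) {U \<in> space (PiM I (\<lambda>_. Q)). 0 \<le> (\<Sum>i\<in>I. h (U i))} \<le> \<rho> ^ card I"
proof -
  interpret Q: product_prob_space "\<lambda>_. Q" I
    by (rule product_prob_spaceI) (rule Q)
  let ?A = "{U \<in> space (PiM I (\<lambda>_. Q)). 0 \<le> (\<Sum>i\<in>I. h (U i))}"
  have [measurable]: "(\<lambda>U. \<Sum>i\<in>I. h (U i)) \<in> borel_measurable (PiM I (\<lambda>_. Q))"
    by measurable
  have A: "?A \<in> sets (PiM I (\<lambda>_. Q))" by measurable
  have "emeasure (PiM I (\<lambda>_. Q)) ?A = (\<integral>\<^sup>+U. indicator ?A U \<partial>PiM I (\<lambda>_. Q))"
    using A by simp
  also have "\<dots> \<le> (\<integral>\<^sup>+U. (\<Prod>i\<in>I. ennreal (exp (h (U i)))) \<partial>PiM I (\<lambda>_. Q))"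
  proof (rule nn_integral_mono)
    fix U
    have "indicator ?A U \<le> ennreal (exp (\<Sum>i\<in>I. h (U i)))"
      by (auto simp: indicator_def ennreal_1[symmetric] simp del: ennreal_1 intro!: ennreal_leI)
    also have "\<dots> = (\<Prod>i\<in>I. ennreal (exp (h (U i))))"
      using \<open>finite I\<close> by (simp add: exp_sum prod_ennreal)
    finally show "indicator ?A U \<le> (\<Prod>i\<in>I. ennreal (exp (h (U i))))" .
  qed
  also have "\<dots> = (\<Prod>i\<in>I. \<integral>\<^sup>+x. ennreal (exp (h x)) \<partial>Q)"
    by (rule Q.product_nn_integral_prod[OF \<open>finite I\<close>]) simp
  also have "\<dots> = ennreal (\<rho> ^ card I)"
    using \<rho> by (simp add: ennreal_power)
  finally have "emeasure (PiM I (\<lambda>_. Q)) ?A \<le> ennreal (\<rho> ^ card I)" .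
  then show ?thesis
    using \<rho>(2) by (simp add: measure_def enn2real_leI)
qed

section \<open>The Gaussian law as sheared independent noise\<close>

definition noise_law :: "nat \<Rightarrow> real \<Rightarrow> nat \<Rightarrow> real measure" where
  "noise_law a \<sigma> k = density lborel (\<lambda>y. ennreal (normal_density 0 (if k = a then \<sigma> else 1) y))"

lemma sets_noise_law [measurable_cong, simp]: "sets (noise_law a \<sigma> k) = sets borel"
  by (simp add: noise_law_def)

lemma space_noise_law [simp]: "space (noise_law a \<sigma> k) = UNIV"
  by (simp add: noise_law_def)

lemma prob_space_noise_law: "\<sigma> > 0 \<Longrightarrow> prob_space (noise_law a \<sigma> k)"
  unfolding noise_law_def by (rule prob_space_normal_density) auto

lemma noise_law_atomless: "{z} \<in> null_sets (noise_law a \<sigma> k)"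
proof -
  have "AE y in lborel. y \<in> {z} \<longrightarrow> ennreal (normal_density 0 (if k = a then \<sigma> else 1) y) = 0"
    using AE_lborel_singleton[of z] by (rule eventually_mono) simp
  then show ?thesis
    unfolding noise_law_def by (subst null_sets_density_iff) auto
qed

lemma PiM_density:
  assumes M: "product_sigma_finite M" and I: "finite I"
    and f: "\<And>i. i \<in> I \<Longrightarrow> f i \<in> borel_measurable (M i)"
    and D: "product_sigma_finite (\<lambda>i. density (M i) (f i))"
  shows "PiM I (\<lambda>i. density (M i) (f i)) = density (PiM I M) (\<lambda>x. \<Prod>i\<in>I. f i (x i))"
proof -
  interpret product_sigma_finite M by fact
  interpret D: product_sigma_finite "\<lambda>i. density (M i) (f i)" by fact
  have meas: "(\<lambda>x. \<Prod>i\<in>I. f i (x i)) \<in> borel_measurable (PiM I M)"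
    using f by (intro borel_measurable_prod_ennreal)
      (auto intro: measurable_compose[OF measurable_component_singleton])
  show ?thesis
  proof (rule D.PiM_eqI[symmetric, OF I])
    show "sets (density (PiM I M) (\<lambda>x. \<Prod>i\<in>I. f i (x i))) = sets (PiM I (\<lambda>i. density (M i) (f i)))"
      by (simp cong: sets_PiM_cong)
  next
    fix A assume "\<And>i. i \<in> I \<Longrightarrow> A i \<in> sets (density (M i) (f i))"
    then have A: "A i \<in> sets (M i)" if "i \<in> I" for i using that by simp
    have "emeasure (density (PiM I M) (\<lambda>x. \<Prod>i\<in>I. f i (x i))) (Pi\<^sub>E I A) =
        (\<integral>\<^sup>+x. (\<Prod>i\<in>I. f i (x i)) * indicator (Pi\<^sub>E I A) x \<partial>PiM I M)"
      using A I by (intro emeasure_density[OF meas] sets_PiM_I_finite)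
    also have "\<dots> = (\<integral>\<^sup>+x. (\<Prod>i\<in>I. f i (x i) * indicator (A i) (x i)) \<partial>PiM I M)"
    proof (rule nn_integral_cong)
      fix x assume x: "x \<in> space (PiM I M)"
      have "indicator (Pi\<^sub>E I A) x = (\<Prod>i\<in>I. indicator (A i) (x i) :: ennreal)"
        using x I by (auto simp: indicator_def space_PiM PiE_def extensional_def Pi_def prod_zero_iff)
      then show "(\<Prod>i\<in>I. f i (x i)) * indicator (Pi\<^sub>E I A) x = (\<Prod>i\<in>I. f i (x i) * indicator (A i) (x i))"
        by (simp add: prod.distrib)
    qed
    also have "\<dots> = (\<Prod>i\<in>I. \<integral>\<^sup>+y. f i y * indicator (A i) y \<partial>M i)"
      using f A by (intro product_nn_integral_prod[OF I]) auto
    also have "\<dots> = (\<Prod>i\<in>I. emeasure (density (M i) (f i)) (A i))"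
      using f A by (intro prod.cong refl) (simp add: emeasure_density)
    finally show "emeasure (density (PiM I M) (\<lambda>x. \<Prod>i\<in>I. f i (x i))) (Pi\<^sub>E I A) =
        (\<Prod>i\<in>I. emeasure (density (M i) (f i)) (A i))" .
  qed
qed

text \<open>Both the covariance matrix and its inverse have this shape, with \<open>(d, e) = (1, s)\<close> and
  \<open>(d, e) = (1, - s) / (1 - s\<^sup>2)\<close>.\<close>

definition pair_mat :: "nat \<Rightarrow> nat \<Rightarrow> real \<Rightarrow> real \<Rightarrow> nat \<Rightarrow> nat \<Rightarrow> real" where
  "pair_mat a b d e i j =
     (if i = j then if i \<in> {a, b} then d else 1 else if {i, j} = {a, b} then e else 0)"

lemma sum_pair_mat:
  assumes "finite V" "a \<in> V" "b \<in> V" "a \<noteq> b" "i \<in> V"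
  shows "(\<Sum>j\<in>V. pair_mat a b d e i j * f j) =
    (if i = a then d * f a + e * f b else if i = b then d * f b + e * f a else f i)"
proof -
  have "(\<Sum>j\<in>V. pair_mat a b d e i j * f j) = (\<Sum>j\<in>{a, b, i}. pair_mat a b d e i j * f j)"
    using assms by (intro sum.mono_neutral_right) (auto simp: pair_mat_def)
  then show ?thesis
    using assms(4) by (auto simp: pair_mat_def doubleton_eq_iff insert_commute)
qed

lemma sum_nodes: "(\<Sum>k\<in>{0..<p}. f (Suc k)) = sum f {1..p}"
  by (simp add: sum.atLeast1_atMost_eq atLeast0LessThan)

lemma mat_inverse_pair:
  assumes ab: "a \<in> {1..p}" "b \<in> {1..p}" "a \<noteq> b" and s: "s\<^sup>2 \<noteq> 1"
    and S: "\<And>i j. i \<in> {1..p} \<Longrightarrow> j \<in> {1..p} \<Longrightarrow> S i j = pair_mat a b 1 s i j"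
  shows "mat_inverse (node_mat p S) =
    Some (node_mat p (pair_mat a b (1 / (1 - s\<^sup>2)) (- s / (1 - s\<^sup>2))))"
proof -
  let ?A = "node_mat p S" and ?C = "node_mat p (pair_mat a b (1 / (1 - s\<^sup>2)) (- s / (1 - s\<^sup>2)))"
  have cA: "?A \<in> carrier_mat p p" and cC: "?C \<in> carrier_mat p p" by (simp_all add: node_mat_def)
  have s': "1 - s\<^sup>2 \<noteq> 0" using s by simp
  have AC: "?A * ?C = 1\<^sub>m p"
  proof (rule eq_matI)
    fix i j assume "i < dim_row (1\<^sub>m p :: real mat)" "j < dim_col (1\<^sub>m p :: real mat)"
    then have ij: "i < p" "j < p" by auto
    let ?c = "\<lambda>k. pair_mat a b (1 / (1 - s\<^sup>2)) (- s / (1 - s\<^sup>2)) k (Suc j)"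
    have "(?A * ?C) $$ (i, j) = (\<Sum>k\<in>{0..<p}. S (Suc i) (Suc k) * ?c (Suc k))"
      using ij by (simp add: node_mat_def scalar_prod_def)
    also have "\<dots> = (\<Sum>k\<in>{0..<p}. pair_mat a b 1 s (Suc i) (Suc k) * ?c (Suc k))"
      using ij by (intro sum.cong) (auto simp: S)
    also have "\<dots> = (\<Sum>k\<in>{1..p}. pair_mat a b 1 s (Suc i) k * ?c k)"
      by (rule sum_nodes)
    also have "\<dots> = (if Suc i = a then 1 * ?c a + s * ?c b else if Suc i = b then 1 * ?c b + s * ?c a else ?c (Suc i))"
      using ab ij by (intro sum_pair_mat) auto
    also have "\<dots> = (1\<^sub>m p :: real mat) $$ (i, j)"
      using ij ab(3) s' by (auto simp: pair_mat_def doubleton_eq_iff power2_eq_square diff_divide_distrib[symmetric])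
    finally show "(?A * ?C) $$ (i, j) = (1\<^sub>m p :: real mat) $$ (i, j)" .
  qed (simp_all add: node_mat_def)
  have CA: "?C * ?A = 1\<^sub>m p" using mat_mult_left_right_inverse[OF cA cC AC] .
  show ?thesis
  proof (cases "mat_inverse ?A")
    case None
    have "?A \<in> Units (ring_mat TYPE(real) p undefined)"
      using cA cC AC CA by (auto simp: Units_def ring_mat_def)
    then show ?thesis using mat_inverse(1)[OF cA None, of undefined] by blast
  next
    case (Some B)
    then have B: "B * ?A = 1\<^sub>m p" "B \<in> carrier_mat p p" using mat_inverse(2)[OF cA Some] by auto
    have "B = B * (?A * ?C)" using B AC by simp
    also have "\<dots> = B * ?A * ?C" by (rule assoc_mult_mat[symmetric, OF B(2) cA cC])
    also have "\<dots> = ?C" unfolding B(1) using cC by (rule left_mult_one_mat)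
    finally show ?thesis using Some by simp
  qed
qed

text \<open>Completing the square in \<open>x a\<close> turns the exponent into that of independent normal variables.\<close>

lemma quadratic_form_pair:
  assumes ab: "a \<in> {1..p}" "b \<in> {1..p}" "a \<noteq> b" and s: "s\<^sup>2 \<noteq> 1"
    and S: "\<And>i j. i \<in> {1..p} \<Longrightarrow> j \<in> {1..p} \<Longrightarrow> S i j = pair_mat a b 1 s i j"
  shows "scalar_prod (node_vec p x) (mult_mat_vec (the (mat_inverse (node_mat p S))) (node_vec p x)) =
    (\<Sum>k\<in>{1..p} - {a}. (x k)\<^sup>2) + (x a - s * x b)\<^sup>2 / (1 - s\<^sup>2)"
proof -
  let ?d = "1 / (1 - s\<^sup>2)" and ?e = "- s / (1 - s\<^sup>2)"
  let ?f = "\<lambda>i. \<Sum>j\<in>{1..p}. pair_mat a b ?d ?e i j * x j"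
  have "scalar_prod (node_vec p x) (mult_mat_vec (the (mat_inverse (node_mat p S))) (node_vec p x)) =
     (\<Sum>i\<in>{0..<p}. x (Suc i) * (\<Sum>j\<in>{0..<p}. pair_mat a b ?d ?e (Suc i) (Suc j) * x (Suc j)))"
    unfolding mat_inverse_pair[OF ab s S, simplified] option.sel
    by (simp add: node_vec_def node_mat_def scalar_prod_def)
  also have "\<dots> = (\<Sum>i\<in>{1..p}. x i * ?f i)"
    unfolding sum_nodes[where f = "\<lambda>j. pair_mat a b ?d ?e _ j * x j"]
    by (rule sum_nodes)
  also have "\<dots> = (\<Sum>i\<in>{1..p}. if i = a then x a * (?d * x a + ?e * x b)
      else if i = b then x b * (?d * x b + ?e * x a) else (x i)\<^sup>2)"
    using ab by (intro sum.cong refl) (auto simp only: sum_pair_mat[OF finite_atLeastAtMost ab] power2_eq_square split: if_split)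
  also have "\<dots> = x a * (?d * x a + ?e * x b) + (x b * (?d * x b + ?e * x a) + (\<Sum>i\<in>{1..p} - {a} - {b}. (x i)\<^sup>2))"
    using ab by (subst sum.remove[of _ a]; simp; subst sum.remove[of _ b]) (auto intro!: sum.cong)
  also have "\<dots> = (x b)\<^sup>2 + (\<Sum>i\<in>{1..p} - {a} - {b}. (x i)\<^sup>2) + (x a - s * x b)\<^sup>2 / (1 - s\<^sup>2)"
  proof -
    define q where "q = 1 - s\<^sup>2"
    have "q \<noteq> 0" using s by (simp add: q_def)
    have "(x a - s * x b)\<^sup>2 = (x a)\<^sup>2 - 2 * s * x a * x b + (1 - q) * (x b)\<^sup>2"
      by (simp add: q_def power2_eq_square algebra_simps)
    then have "x a * (1 / q * x a + - s / q * x b) + x b * (1 / q * x b + - s / q * x a) =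
        (x b)\<^sup>2 + (x a - s * x b)\<^sup>2 / q"
      using \<open>q \<noteq> 0\<close> by (simp add: field_simps power2_eq_square)
    then show ?thesis unfolding q_def[symmetric] by simp
  qed
  also have "\<dots> = (\<Sum>k\<in>{1..p} - {a}. (x k)\<^sup>2) + (x a - s * x b)\<^sup>2 / (1 - s\<^sup>2)"
    using ab by (subst sum.remove[of "{1..p} - {a}" b]) auto
  finally show ?thesis .
qed


lemma normal_second_moment:
  assumes "\<sigma> > 0"
  shows "(\<integral>\<^sup>+y. ennreal ((A + c * y)\<^sup>2) \<partial>density lborel (\<lambda>y. ennreal (normal_density 0 \<sigma> y))) =
    ennreal (A\<^sup>2 + c\<^sup>2 * \<sigma>\<^sup>2)"
proof -
  have m0: "has_bochner_integral lborel (normal_density 0 \<sigma>) 1"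
    using assms by (simp add: has_bochner_integral_iff)
  have m1: "has_bochner_integral lborel (\<lambda>y. normal_density 0 \<sigma> y * y) 0"
    by (rule normal_moment_nz_1[OF assms])
  have m2: "has_bochner_integral lborel (\<lambda>y. normal_density 0 \<sigma> y * y\<^sup>2) (\<sigma>\<^sup>2)"
    using normal_moment_even[OF assms, of 0 1] by (simp add: fact_2 power2_eq_square)
  have "has_bochner_integral lborel (\<lambda>y. A\<^sup>2 * normal_density 0 \<sigma> y
      + (2 * A * c * (normal_density 0 \<sigma> y * y) + c\<^sup>2 * (normal_density 0 \<sigma> y * y\<^sup>2)))
     (A\<^sup>2 * 1 + (2 * A * c * 0 + c\<^sup>2 * \<sigma>\<^sup>2))"
    by (intro has_bochner_integral_add has_bochner_integral_mult_right m0 m1 m2)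
  also have "(\<lambda>y. A\<^sup>2 * normal_density 0 \<sigma> y
      + (2 * A * c * (normal_density 0 \<sigma> y * y) + c\<^sup>2 * (normal_density 0 \<sigma> y * y\<^sup>2))) =
      (\<lambda>y. normal_density 0 \<sigma> y * (A + c * y)\<^sup>2)"
    by (rule ext) (simp add: power2_eq_square algebra_simps)
  finally have H: "has_bochner_integral lborel (\<lambda>y. normal_density 0 \<sigma> y * (A + c * y)\<^sup>2) (A\<^sup>2 + c\<^sup>2 * \<sigma>\<^sup>2)"
    by simp
  have "(\<integral>\<^sup>+y. ennreal ((A + c * y)\<^sup>2) \<partial>density lborel (\<lambda>y. ennreal (normal_density 0 \<sigma> y))) =
      (\<integral>\<^sup>+y. ennreal (normal_density 0 \<sigma> y * (A + c * y)\<^sup>2) \<partial>lborel)"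
    by (subst nn_integral_density) (simp_all add: ennreal_mult')
  also have "\<dots> = ennreal (A\<^sup>2 + c\<^sup>2 * \<sigma>\<^sup>2)"
    using H by (subst nn_integral_eq_integral) (auto simp: has_bochner_integral_iff)
  finally show ?thesis .
qed

lemma borel_measurable_ennreal_normal:
  "(\<lambda>y. ennreal (normal_density \<mu> \<sigma> y)) \<in> borel_measurable lborel"
  by simp

text \<open>The exponential moment of a standard normal variable contributes \<open>exp (x\<^sup>2 / 2)\<close> whatever the sign \<open>\<eta>\<close>;
  the subtracted square leaves a bounded function of \<open>x\<close> for the second integration.\<close>

lemma normal_mgf_cross:
  fixes \<eta> x :: real
  assumes "\<eta>\<^sup>2 = 1"
  shows "(\<integral>\<^sup>+y. ennreal (exp (\<eta> * y * x - x\<^sup>2)) \<partial>density lborel (\<lambda>y. ennreal (normal_density 0 1 y))) =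
    ennreal (exp (- x\<^sup>2 / 2))"
proof -
  have meas1: "(\<lambda>y. ennreal (exp (\<eta> * y * x - x\<^sup>2))) \<in> borel_measurable lborel" by simp
  have "(\<integral>\<^sup>+y. ennreal (exp (\<eta> * y * x - x\<^sup>2)) \<partial>density lborel (\<lambda>y. ennreal (normal_density 0 1 y))) =
      (\<integral>\<^sup>+y. ennreal (exp (- x\<^sup>2 / 2)) * ennreal (normal_density (\<eta> * x) 1 y) \<partial>lborel)"
    unfolding nn_integral_density[OF borel_measurable_ennreal_normal meas1]
  proof (intro nn_integral_cong)
    fix y
    have "- y\<^sup>2 / 2 + (\<eta> * y * x - x\<^sup>2) = - x\<^sup>2 / 2 + (- (y - \<eta> * x)\<^sup>2 / 2)"
      using assms by (simp add: power2_diff power_mult_distrib field_simps)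
    then have "normal_density 0 1 y * exp (\<eta> * y * x - x\<^sup>2) = exp (- x\<^sup>2 / 2) * normal_density (\<eta> * x) 1 y"
      by (simp add: normal_density_def exp_add[symmetric])
    then show "ennreal (normal_density 0 1 y) * ennreal (exp (\<eta> * y * x - x\<^sup>2)) =
        ennreal (exp (- x\<^sup>2 / 2)) * ennreal (normal_density (\<eta> * x) 1 y)"
      by (simp add: ennreal_mult[symmetric])
  qed
  also have "\<dots> = ennreal (exp (- x\<^sup>2 / 2)) * (\<integral>\<^sup>+y. ennreal (normal_density (\<eta> * x) 1 y) \<partial>lborel)"
    by (rule nn_integral_cmult) simp
  also have "(\<integral>\<^sup>+y. ennreal (normal_density (\<eta> * x) 1 y) \<partial>lborel) = 1"
    by (subst nn_integral_eq_integral) auto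
  finally show ?thesis by simp
qed

lemma normal_mgf_square:
  "(\<integral>\<^sup>+y. ennreal (exp (- y\<^sup>2 / 2)) \<partial>density lborel (\<lambda>y. ennreal (normal_density 0 1 y))) =
    ennreal (1 / sqrt 2)"
proof -
  have meas1: "(\<lambda>y::real. ennreal (exp (- y\<^sup>2 / 2))) \<in> borel_measurable lborel" by simp
  have "(\<integral>\<^sup>+y. ennreal (exp (- y\<^sup>2 / 2)) \<partial>density lborel (\<lambda>y. ennreal (normal_density 0 1 y))) =
      (\<integral>\<^sup>+y. ennreal (1 / sqrt 2) * ennreal (normal_density 0 (1 / sqrt 2) y) \<partial>lborel)"
    unfolding nn_integral_density[OF borel_measurable_ennreal_normal meas1]
  proof (intro nn_integral_cong)
    fix y :: real
    have "normal_density 0 1 y * exp (- y\<^sup>2 / 2) = 1 / sqrt 2 * normal_density 0 (1 / sqrt 2) y"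
      by (simp add: normal_density_def exp_add[symmetric] real_sqrt_mult power_divide)
    then show "ennreal (normal_density 0 1 y) * ennreal (exp (- y\<^sup>2 / 2)) =
        ennreal (1 / sqrt 2) * ennreal (normal_density 0 (1 / sqrt 2) y)"
      by (simp add: ennreal_mult[symmetric])
  qed
  also have "\<dots> = ennreal (1 / sqrt 2) * (\<integral>\<^sup>+y. ennreal (normal_density 0 (1 / sqrt 2) y) \<partial>lborel)"
    by (rule nn_integral_cmult) simp
  also have "(\<integral>\<^sup>+y. ennreal (normal_density 0 (1 / sqrt 2) y) \<partial>lborel) = 1"
    by (subst nn_integral_eq_integral) auto
  finally show ?thesis by simp
qed


lemma product_sigma_finite_lborel: "product_sigma_finite (\<lambda>_. lborel :: real measure)"
  by (simp add: product_sigma_finite_def lborel.sigma_finite_measure_axioms)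

lemma PiM_noise_law:
  assumes "\<sigma> > 0" "finite V"
  shows "PiM V (noise_law a \<sigma>) = density (PiM V (\<lambda>_. lborel))
     (\<lambda>x. \<Prod>k\<in>V. ennreal (normal_density 0 (if k = a then \<sigma> else 1) (x k)))"
  unfolding noise_law_def
proof (rule PiM_density[OF product_sigma_finite_lborel assms(2)])
  show "product_sigma_finite (\<lambda>i. density lborel (\<lambda>y. ennreal (normal_density 0 (if i = a then \<sigma> else 1) y)))"
    using prob_space_noise_law[OF assms(1)]
    by (auto simp: product_sigma_finite_def noise_law_def prob_space_imp_sigma_finite)
qed simp

lemma measurable_add_multiple:
  assumes "a \<in> V" "b \<in> V"
  shows "(\<lambda>x. x(a := x a + s * x b)) \<in> measurable (PiM V (\<lambda>_. borel)) (PiM V (\<lambda>_. borel :: real measure))"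
  using assms by (intro measurable_fun_upd[where J = V]) (auto simp: insert_absorb)

lemma nn_integral_lborel_shift:
  fixes f :: "real \<Rightarrow> ennreal"
  assumes "f \<in> borel_measurable borel"
  shows "(\<integral>\<^sup>+y. f y \<partial>lborel) = (\<integral>\<^sup>+y. f (y + t) \<partial>lborel)"
  using nn_integral_real_affine[OF assms, of 1 t] by (simp add: add.commute)

lemma nn_integral_lborel_shear:
  assumes V: "finite V" "a \<in> V" "b \<in> V" "a \<noteq> b"
    and f: "f \<in> borel_measurable (PiM V (\<lambda>_. borel :: real measure))"
  shows "(\<integral>\<^sup>+x. f x \<partial>PiM V (\<lambda>_. lborel)) = (\<integral>\<^sup>+x. f (x(a := x a + s * x b)) \<partial>PiM V (\<lambda>_. lborel))"
proof -
  interpret product_sigma_finite "\<lambda>_. lborel :: real measure" by (rule product_sigma_finite_lborel)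
  define J where "J = V - {a}"
  have J: "finite J" "a \<notin> J" and VJ: "V = insert a J" using V by (auto simp: J_def)
  have sets_eq: "sets (PiM W (\<lambda>_. lborel)) = sets (PiM W (\<lambda>_. borel :: real measure))" for W
    by (rule sets_PiM_cong) auto
  have f1: "f \<in> borel_measurable (PiM (insert a J) (\<lambda>_. lborel))"
    using f by (simp add: VJ measurable_cong_sets[OF sets_eq refl])
  have f2: "(\<lambda>x. f (x(a := x a + s * x b))) \<in> borel_measurable (PiM (insert a J) (\<lambda>_. lborel))"
    using measurable_compose[OF measurable_add_multiple[OF V(2,3)] f]
    by (simp add: VJ measurable_cong_sets[OF sets_eq refl])
  have "(\<integral>\<^sup>+x. f x \<partial>PiM V (\<lambda>_. lborel)) = (\<integral>\<^sup>+x. (\<integral>\<^sup>+y. f (x(a := y)) \<partial>lborel) \<partial>PiM J (\<lambda>_. lborel))"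
    unfolding VJ by (rule product_nn_integral_insert[OF J f1])
  also have "\<dots> = (\<integral>\<^sup>+x. (\<integral>\<^sup>+y. f (x(a := y + s * x b)) \<partial>lborel) \<partial>PiM J (\<lambda>_. lborel))"
  proof (rule nn_integral_cong)
    fix x assume x: "x \<in> space (PiM J (\<lambda>_. lborel :: real measure))"
    have "(\<lambda>y. x(a := y)) \<in> measurable borel (PiM V (\<lambda>_. borel))"
      using x J_def V by (intro measurable_fun_upd[where J = J]) (auto simp: space_PiM)
    then have "(\<lambda>y. f (x(a := y))) \<in> borel_measurable borel"
      using f by (rule measurable_compose)
    then show "(\<integral>\<^sup>+y. f (x(a := y)) \<partial>lborel) = (\<integral>\<^sup>+y. f (x(a := y + s * x b)) \<partial>lborel)"
      by (rule nn_integral_lborel_shift)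
  qed
  also have "\<dots> = (\<integral>\<^sup>+x. f (x(a := x a + s * x b)) \<partial>PiM V (\<lambda>_. lborel))"
    unfolding VJ using V(4) by (subst product_nn_integral_insert[OF J f2]) simp
  finally show ?thesis .
qed

text \<open>The shear that adds \<open>s\<close> times coordinate \<open>b\<close> to coordinate \<open>a\<close> preserves Lebesgue measure, so the densities
  of the two laws agree up to a constant, and the constant is one because both laws have total mass one. The determinant in the density is therefore never
  computed.\<close>

lemma mvn_eq_distr_noise:
  assumes ab: "a \<in> {1..p}" "b \<in> {1..p}" "a \<noteq> b" and s: "0 < s" "s < 1"
    and S: "\<And>i j. i \<in> {1..p} \<Longrightarrow> j \<in> {1..p} \<Longrightarrow> S i j = pair_mat a b 1 s i j"
    and pr: "prob_space (mvn p S)"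
  shows "mvn p S = distr (PiM {1..p} (noise_law a (sqrt (1 - s\<^sup>2)))) (PiM {1..p} (\<lambda>_. borel))
      (\<lambda>x. x(a := x a + s * x b))"
proof -
  let ?V = "{1..p}" and ?L = "PiM {1..p} (\<lambda>_. lborel :: real measure)"
  define \<sigma> where "\<sigma> = sqrt (1 - s\<^sup>2)"
  have s2: "s\<^sup>2 < 1" using s by (simp add: power_less_one_iff abs_square_less_1)
  have \<sigma>: "\<sigma> > 0" "\<sigma>\<^sup>2 = 1 - s\<^sup>2" using s2 by (simp_all add: \<sigma>_def)
  let ?Q = "PiM ?V (noise_law a \<sigma>)"
  define T where "T = (\<lambda>x :: nat \<Rightarrow> real. x(a := x a + s * x b))"
  define nd where "nd = (\<lambda>k. normal_density 0 (if k = a then \<sigma> else 1))"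
  define Z where "Z = (\<Prod>k\<in>?V. 1 / sqrt (2 * pi * (if k = a then \<sigma> else 1)\<^sup>2))"
  define c where "c = 1 / sqrt ((2 * pi) ^ p * Determinant.det (node_mat p S)) / Z"
  have Z: "Z > 0" unfolding Z_def using \<sigma>(1) by (intro prod_pos) auto
  have dens_T: "mvn_density p S (T x) = c * (\<Prod>k\<in>?V. nd k (x k))" for x
  proof -
    have "scalar_prod (node_vec p (T x)) (mult_mat_vec (the (mat_inverse (node_mat p S))) (node_vec p (T x))) =
        (\<Sum>k\<in>?V - {a}. (T x k)\<^sup>2) + (T x a - s * T x b)\<^sup>2 / (1 - s\<^sup>2)"
      by (rule quadratic_form_pair[OF ab _ S]) (use s2 in auto)
    also have "\<dots> = (\<Sum>k\<in>?V - {a}. (x k)\<^sup>2) + (x a)\<^sup>2 / \<sigma>\<^sup>2"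
      using ab(3) by (simp add: T_def \<sigma>)
    also have "\<dots> = (\<Sum>k\<in>?V. (x k)\<^sup>2 / (if k = a then \<sigma> else 1)\<^sup>2)"
      using ab(1) by (subst sum.remove[of ?V a]) auto
    finally have q: "scalar_prod (node_vec p (T x))
        (mult_mat_vec (the (mat_inverse (node_mat p S))) (node_vec p (T x))) = \<dots>" .
    have "(\<Prod>k\<in>?V. nd k (x k)) = Z * exp (\<Sum>k\<in>?V. - ((x k)\<^sup>2 / (if k = a then \<sigma> else 1)\<^sup>2) / 2)"
      unfolding exp_sum[OF finite_atLeastAtMost] Z_def prod.distrib[symmetric]
      by (intro prod.cong refl) (simp add: nd_def normal_density_def)
    also have "(\<Sum>k\<in>?V. - ((x k)\<^sup>2 / (if k = a then \<sigma> else 1)\<^sup>2) / 2) =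
        - (\<Sum>k\<in>?V. (x k)\<^sup>2 / (if k = a then \<sigma> else 1)\<^sup>2) / 2"
      by (simp only: sum_negf[symmetric] sum_divide_distrib)
    finally show ?thesis
      unfolding mvn_density_def q c_def using Z by simp
  qed
  have sets_eq: "sets ?L = sets (PiM ?V (\<lambda>_. borel :: real measure))"
    by (rule sets_PiM_cong) auto
  have Tm: "T \<in> measurable (PiM ?V (\<lambda>_. borel)) (PiM ?V (\<lambda>_. borel))"
    unfolding T_def by (rule measurable_add_multiple[OF ab(1,2)])
  have TQ: "T \<in> measurable ?Q (PiM ?V (\<lambda>_. borel))"
    using Tm by (subst measurable_cong_sets[OF sets_PiM_cong refl]) auto
  have ndm: "(\<lambda>x. \<Prod>k\<in>?V. nd k (x k)) \<in> borel_measurable (PiM ?V (\<lambda>_. borel))"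
    unfolding nd_def by measurable
  have densm: "mvn_density p S \<in> borel_measurable (PiM ?V (\<lambda>_. borel))"
  proof -
    define T' where "T' = (\<lambda>x :: nat \<Rightarrow> real. x(a := x a + (- s) * x b))"
    have "T' \<in> measurable (PiM ?V (\<lambda>_. borel)) (PiM ?V (\<lambda>_. borel))"
      unfolding T'_def by (rule measurable_add_multiple[OF ab(1,2)])
    then have "(\<lambda>x. c * (\<Prod>k\<in>?V. nd k (T' x k))) \<in> borel_measurable (PiM ?V (\<lambda>_. borel))"
      using ndm by (auto intro: borel_measurable_times measurable_compose)
    moreover have "T (T' x) = x" for x using ab(3) by (auto simp: T_def T'_def)
    then have "mvn_density p S = (\<lambda>x. c * (\<Prod>k\<in>?V. nd k (T' x k)))"
      using dens_T[of "T' _"] by (intro ext) simp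
    ultimately show ?thesis by (simp only:)
  qed
  have em: "emeasure (mvn p S) A = ennreal c * emeasure (distr ?Q (PiM ?V (\<lambda>_. borel)) T) A"
    if A: "A \<in> sets (PiM ?V (\<lambda>_. borel))" for A
  proof -
    have "emeasure (mvn p S) A = (\<integral>\<^sup>+x. ennreal (mvn_density p S x) * indicator A x \<partial>?L)"
      unfolding mvn_def using densm A
      by (intro emeasure_density) (simp_all add: sets_eq measurable_cong_sets[OF sets_eq refl])
    also have "\<dots> = (\<integral>\<^sup>+x. ennreal (mvn_density p S (T x)) * indicator A (T x) \<partial>?L)"
      unfolding T_def using densm A
      by (intro nn_integral_lborel_shear ab) auto
    also have "\<dots> = (\<integral>\<^sup>+x. ennreal c * ((\<Prod>k\<in>?V. ennreal (nd k (x k))) * indicator A (T x)) \<partial>?L)"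
      by (intro nn_integral_cong)
        (simp add: dens_T nd_def ennreal_mult'' prod_nonneg prod_ennreal mult.assoc)
    also have "\<dots> = ennreal c * (\<integral>\<^sup>+x. (\<Prod>k\<in>?V. ennreal (nd k (x k))) * indicator A (T x) \<partial>?L)"
    proof (rule nn_integral_cmult)
      have "(\<lambda>x. (\<Prod>k\<in>?V. ennreal (nd k (x k))) * indicator A (T x)) \<in> borel_measurable (PiM ?V (\<lambda>_. borel))"
        using Tm A unfolding nd_def by measurable
      then show "(\<lambda>x. (\<Prod>k\<in>?V. ennreal (nd k (x k))) * indicator A (T x)) \<in> borel_measurable ?L"
        by (simp add: measurable_cong_sets[OF sets_eq refl])
    qed
    also have "(\<integral>\<^sup>+x. (\<Prod>k\<in>?V. ennreal (nd k (x k))) * indicator A (T x) \<partial>?L) =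
        (\<integral>\<^sup>+x. indicator A (T x) \<partial>?Q)"
      unfolding PiM_noise_law[OF \<sigma>(1) finite_atLeastAtMost] nd_def
    proof (rule nn_integral_density[symmetric])
      have "(\<lambda>x. \<Prod>k\<in>?V. ennreal (normal_density 0 (if k = a then \<sigma> else 1) (x k))) \<in> borel_measurable (PiM ?V (\<lambda>_. borel))"
        by measurable
      then show "(\<lambda>x. \<Prod>k\<in>?V. ennreal (normal_density 0 (if k = a then \<sigma> else 1) (x k))) \<in> borel_measurable ?L"
        by (simp add: measurable_cong_sets[OF sets_eq refl])
      have "(\<lambda>x. indicator A (T x) :: ennreal) \<in> borel_measurable (PiM ?V (\<lambda>_. borel))"
        using Tm A by measurable
      then show "(\<lambda>x. indicator A (T x) :: ennreal) \<in> borel_measurable ?L"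
        by (simp add: measurable_cong_sets[OF sets_eq refl])
    qed
    also have "\<dots> = emeasure (distr ?Q (PiM ?V (\<lambda>_. borel)) T) A"
      using A TQ by (subst nn_integral_distr[symmetric, OF TQ]) auto
    finally show ?thesis .
  qed
  have "prob_space ?Q" using prob_space_noise_law[OF \<sigma>(1)] by (rule prob_space_PiM)
  then have prT: "prob_space (distr ?Q (PiM ?V (\<lambda>_. borel)) T)"
    using TQ by (rule prob_space.prob_space_distr)
  have sp: "space (mvn p S) = space (PiM ?V (\<lambda>_. borel :: real measure))"
    by (simp add: mvn_def space_PiM)
  have sets_mvn: "sets (mvn p S) = sets (PiM ?V (\<lambda>_. borel))"
    by (simp only: mvn_def sets_density sets_eq)
  have "ennreal c = 1"
    using em[of "space (PiM ?V (\<lambda>_. borel))"] prob_space.emeasure_space_1[OF pr]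
      prob_space.emeasure_space_1[OF prT] by (simp add: sp)
  then have "mvn p S = distr ?Q (PiM ?V (\<lambda>_. borel)) T"
    using em by (intro measure_eqI) (simp_all only: sets_mvn sets_distr mult_1)
  then show ?thesis by (simp add: T_def \<sigma>_def)
qed

section \<open>Prediction risk and neighborhood of a correlated pair\<close>

locale gaussian_pair =
  fixes V :: "nat set" and a b :: nat and s :: real
  assumes finite_V: "finite V" and aV: "a \<in> V" and bV: "b \<in> V" and ab: "a \<noteq> b"
    and s: "0 < s" "s < 1"
begin

definition \<sigma> :: real where "\<sigma> = sqrt (1 - s\<^sup>2)"

definition noise_row :: "(nat \<Rightarrow> real) measure" where "noise_row = PiM V (noise_law a \<sigma>)"

definition shear :: "(nat \<Rightarrow> real) \<Rightarrow> nat \<Rightarrow> real" where "shear x = x(a := x a + s * x b)"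

definition observation :: "(nat \<Rightarrow> real) measure" where "observation = distr noise_row (PiM V (\<lambda>_. borel)) shear"

lemma sigma_pos: "\<sigma> > 0" and sigma_sq: "\<sigma>\<^sup>2 = 1 - s\<^sup>2"
proof -
  have "s\<^sup>2 < 1" using s by (simp add: abs_square_less_1)
  then show "\<sigma> > 0" "\<sigma>\<^sup>2 = 1 - s\<^sup>2" by (simp_all add: \<sigma>_def)
qed

lemma prob_noise: "prob_space (noise_law a \<sigma> k)"
  using sigma_pos by (rule prob_space_noise_law)

lemma prob_noise_row: "prob_space noise_row"
  unfolding noise_row_def by (rule prob_space_PiM) (rule prob_noise)

lemma sets_noise_row: "sets noise_row = sets (PiM V (\<lambda>_. borel))"
  unfolding noise_row_def by (rule sets_PiM_cong) auto

lemma measurable_shear: "shear \<in> measurable noise_row (PiM V (\<lambda>_. borel))"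
  using measurable_add_multiple[OF aV bV, of s] unfolding shear_def
  by (subst measurable_cong_sets[OF sets_noise_row refl])

lemma sets_observation: "sets observation = sets (PiM V (\<lambda>_. borel))"
  by (simp add: observation_def)

lemma space_observation: "space observation = PiE V (\<lambda>_. UNIV)"
  by (simp add: observation_def space_PiM)

lemma space_noise_row: "space noise_row = PiE V (\<lambda>_. UNIV)"
  by (simp add: noise_row_def space_PiM)

lemma prob_observation: "prob_space observation"
  unfolding observation_def using prob_noise_row measurable_shear by (rule prob_space.prob_space_distr)

lemma measurable_coord: "k \<in> V \<Longrightarrow> (\<lambda>x. x k) \<in> borel_measurable observation"
  "k \<in> V \<Longrightarrow> (\<lambda>x. x k) \<in> borel_measurable noise_row"
  by (simp_all add: measurable_cong_sets[OF sets_observation refl] measurable_cong_sets[OF sets_noise_row refl])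

lemma distr_observation_noise: "distr observation noise_row (\<lambda>x. x(a := x a - s * x b)) = noise_row"
proof -
  let ?U = "\<lambda>x :: nat \<Rightarrow> real. x(a := x a - s * x b)"
  have U: "?U \<in> measurable (PiM V (\<lambda>_. borel)) noise_row"
    using measurable_add_multiple[OF aV bV, of "- s"]
    by (subst measurable_cong_sets[OF refl sets_noise_row]) simp
  have "distr observation noise_row ?U = distr noise_row noise_row (?U \<circ> shear)"
    unfolding observation_def by (rule distr_distr[OF U measurable_shear])
  also have "?U \<circ> shear = (\<lambda>x. x)" using ab by (auto simp: shear_def)
  finally show ?thesis by (simp only: distr_id)
qed

lemma second_moment_noise_row:
  assumes "W \<subseteq> V"
  shows "(\<integral>\<^sup>+x. ennreal ((\<Sum>k\<in>W. c k * x k)\<^sup>2) \<partial>noise_row) =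
    ennreal (\<Sum>k\<in>W. (c k)\<^sup>2 * (if k = a then \<sigma> else 1)\<^sup>2)"
  using finite_subset[OF assms finite_V] assms
proof (induction W rule: finite_induct)
  case empty
  then show ?case by simp
next
  case (insert k W)
  interpret noise_row: prob_space noise_row by (rule prob_noise_row)
  have [measurable]: "(\<lambda>x. \<Sum>j\<in>W. c j * x j) \<in> borel_measurable noise_row"
    using insert.prems by (intro borel_measurable_sum borel_measurable_times measurable_coord) auto
  have m: "(\<lambda>x. ennreal ((\<Sum>j\<in>insert k W. c j * x j)\<^sup>2)) \<in> borel_measurable (PiM V (noise_law a \<sigma>))"
    unfolding noise_row_def[symmetric] using insert.prems insert.hyps measurable_coord(2)[of k] by simp
  have "(\<integral>\<^sup>+x. ennreal ((\<Sum>j\<in>insert k W. c j * x j)\<^sup>2) \<partial>noise_row) =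
      (\<integral>\<^sup>+x. (\<integral>\<^sup>+y. ennreal ((\<Sum>j\<in>insert k W. c j * (x(k := y)) j)\<^sup>2) \<partial>noise_law a \<sigma> k) \<partial>noise_row)"
    unfolding noise_row_def
    by (rule nn_integral_PiM_resample[OF prob_noise finite_V _ m]) (use insert.prems in auto)
  also have "\<dots> = (\<integral>\<^sup>+x. ennreal ((\<Sum>j\<in>W. c j * x j)\<^sup>2) + ennreal ((c k)\<^sup>2 * (if k = a then \<sigma> else 1)\<^sup>2) \<partial>noise_row)"
  proof (rule nn_integral_cong)
    fix x
    have "(\<Sum>j\<in>W. c j * (x(k := y)) j) = (\<Sum>j\<in>W. c j * x j)" for y
      using insert.hyps by (intro sum.cong) auto
    then have "(\<Sum>j\<in>insert k W. c j * (x(k := y)) j) = (\<Sum>j\<in>W. c j * x j) + c k * y" for y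
      using insert.hyps by simp
    then show "(\<integral>\<^sup>+y. ennreal ((\<Sum>j\<in>insert k W. c j * (x(k := y)) j)\<^sup>2) \<partial>noise_law a \<sigma> k) =
        ennreal ((\<Sum>j\<in>W. c j * x j)\<^sup>2) + ennreal ((c k)\<^sup>2 * (if k = a then \<sigma> else 1)\<^sup>2)"
      unfolding noise_law_def using sigma_pos
      by (simp only: normal_second_moment zero_less_one ennreal_plus[symmetric] zero_le_power2
          mult_nonneg_nonneg split: if_split) simp
  qed
  also have "\<dots> = (\<integral>\<^sup>+x. ennreal ((\<Sum>j\<in>W. c j * x j)\<^sup>2) \<partial>noise_row) + ennreal ((c k)\<^sup>2 * (if k = a then \<sigma> else 1)\<^sup>2)"
    by (subst nn_integral_add) (auto simp: noise_row.emeasure_space_1)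
  also have "\<dots> = ennreal (\<Sum>k\<in>insert k W. (c k)\<^sup>2 * (if k = a then \<sigma> else 1)\<^sup>2)"
    using insert by (subst insert.IH) (auto simp: sum_nonneg ennreal_plus[symmetric] add.commute simp del: ennreal_plus)
  finally show ?case .
qed

text \<open>In terms of the noise variables the prediction error is \<open>w + (s - \<theta> b) x\<^sub>b - \<Sum>\<theta> k x\<^sub>k\<close>, a sum of
  uncorrelated terms.\<close>

lemma prediction_error_moment:
  assumes "\<theta> a = 0"
  shows "has_bochner_integral observation (\<lambda>x. (x a - (\<Sum>k\<in>V. \<theta> k * x k))\<^sup>2)
    ((1 - s\<^sup>2) + (\<theta> b - s)\<^sup>2 + (\<Sum>k\<in>V - {a, b}. (\<theta> k)\<^sup>2))"
proof (rule has_bochner_integral_nn_integral)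
  let ?f = "\<lambda>x :: nat \<Rightarrow> real. (x a - (\<Sum>k\<in>V. \<theta> k * x k))\<^sup>2"
  let ?v = "(1 - s\<^sup>2) + (\<theta> b - s)\<^sup>2 + (\<Sum>k\<in>V - {a, b}. (\<theta> k)\<^sup>2)"
  define c where "c = (\<lambda>k. if k = a then 1 else if k = b then s - \<theta> b else - \<theta> k)"
  have split: "(\<Sum>k\<in>V. g k) = g a + (g b + (\<Sum>k\<in>V - {a, b}. g k))" for g :: "nat \<Rightarrow> real"
    using sum.remove[OF finite_V aV, of g] sum.remove[of "V - {a}" b g] finite_V bV ab
    by (simp add: Diff_insert[of V b "{a}", symmetric] insert_commute)
  show fm: "?f \<in> borel_measurable observation"
    using aV by (intro borel_measurable_power borel_measurable_diff borel_measurable_sum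
        borel_measurable_times measurable_coord borel_measurable_const) auto
  have "?f (shear x) = (\<Sum>k\<in>V. c k * x k)\<^sup>2" for x
    unfolding split using ab assms by (simp add: shear_def c_def sum_negf algebra_simps)
  then have "(\<integral>\<^sup>+x. ennreal (?f x) \<partial>observation) = (\<integral>\<^sup>+x. ennreal ((\<Sum>k\<in>V. c k * x k)\<^sup>2) \<partial>noise_row)"
    unfolding observation_def using fm
    by (subst nn_integral_distr[OF measurable_shear]) (simp_all add: measurable_cong_sets[OF sets_observation refl])
  also have "\<dots> = ennreal ?v"
    unfolding second_moment_noise_row[OF order_refl] unfolding split
    using ab by (simp add: c_def sigma_sq power2_commute add.assoc)
  finally show "(\<integral>\<^sup>+x. ennreal (?f x) \<partial>observation) = ennreal ?v" .
  have "0 \<le> 1 - s\<^sup>2" using sigma_sq[symmetric] by simp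
  then show "0 \<le> ?v" by (simp add: sum_nonneg)
qed simp

lemma has_mean_zero:
  assumes "k \<in> V"
  shows "has_bochner_integral noise_row (\<lambda>x. x k) 0"
proof -
  interpret P: product_prob_space "noise_law a \<sigma>" V
    by (rule product_prob_spaceI) (rule prob_noise)
  have d: "distr noise_row (noise_law a \<sigma> k) (\<lambda>x. x k) = noise_law a \<sigma> k"
    unfolding noise_row_def by (rule P.PiM_component[OF assms])
  have "has_bochner_integral lborel (\<lambda>y. normal_density 0 (if k = a then \<sigma> else 1) y *\<^sub>R y) 0"
    using normal_moment_nz_1[of "if k = a then \<sigma> else 1" 0] sigma_pos by simp
  then have "has_bochner_integral (noise_law a \<sigma> k) (\<lambda>y. y) 0"
    unfolding noise_law_def by (intro has_bochner_integral_density) auto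
  then have "has_bochner_integral (distr noise_row (noise_law a \<sigma> k) (\<lambda>x. x k)) (\<lambda>y. y) 0"
    by (simp only: d)
  moreover have "(\<lambda>x. x k) \<in> measurable noise_row (noise_law a \<sigma> k)"
    unfolding noise_row_def using assms by (rule measurable_component_singleton)
  ultimately show ?thesis
    by (simp add: has_bochner_integral_iff integrable_distr_eq integral_distr)
qed

text \<open>For \<open>k \<noteq> a\<close> the coordinate \<open>x k\<close> of an observation is itself a noise variable, so it is independent of
  every event that does not change when this noise variable is resampled. For \<open>k = b\<close> such an event must also
  ignore the coordinate \<open>a\<close>, which contains \<open>x b\<close>; this is why the hypothesis speaks about \<open>shear\<close>.\<close>

lemma measure_indep_coord:
  assumes k: "k \<in> V" "k \<noteq> a" and B: "B \<in> sets borel" and G: "G \<in> sets observation"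
    and ins: "\<And>x y. x \<in> space noise_row \<Longrightarrow> shear (x(k := y)) \<in> G \<longleftrightarrow> shear x \<in> G"
  shows "measure observation ({x \<in> space observation. x k \<in> B} \<inter> G) = measure observation {x \<in> space observation. x k \<in> B} * measure observation G"
proof -
  interpret noise_row: prob_space noise_row by (rule prob_noise_row)
  interpret observation: prob_space observation by (rule prob_observation)
  have TQN: "shear \<in> measurable noise_row observation" using measurable_shear by (simp add: measurable_cong_sets[OF refl sets_observation])
  have emN: "emeasure observation H = emeasure noise_row (shear -` H \<inter> space noise_row)" if "H \<in> sets observation" for H
    unfolding observation_def using that by (intro emeasure_distr[OF measurable_shear]) (simp add: sets_observation)
  have BN: "{x \<in> space observation. x k \<in> B} \<in> sets observation"
    using measurable_sets[OF measurable_coord(1)[OF k(1)] B] by (simp add: vimage_def Int_def conj_commute)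
  have ext: "x(k := y) \<in> space noise_row" if "x \<in> space noise_row" for x y
    using that k(1) by (auto simp: space_noise_row)
  have Tk: "shear x k = x k" for x using k(2) by (simp add: shear_def)
  have TN: "shear x \<in> space observation" if "x \<in> space noise_row" for x
    using that aV by (auto simp: space_noise_row space_observation shear_def)
  have key: "emeasure observation ({x \<in> space observation. x k \<in> B} \<inter> H) = emeasure (noise_law a \<sigma> k) B * emeasure observation H"
    if H: "H \<in> sets observation" and ins: "\<And>x y. x \<in> space noise_row \<Longrightarrow> shear (x(k := y)) \<in> H \<longleftrightarrow> shear x \<in> H" for H
  proof -
    have sub: "shear -` ({x \<in> space observation. x k \<in> B} \<inter> H) \<inter> space noise_row \<in> sets (PiM V (noise_law a \<sigma>))"
      using measurable_sets[OF TQN sets.Int[OF BN H]] by (simp add: noise_row_def)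
    have "emeasure observation ({x \<in> space observation. x k \<in> B} \<inter> H) =
        emeasure noise_row (shear -` ({x \<in> space observation. x k \<in> B} \<inter> H) \<inter> space noise_row)"
      by (rule emN[OF sets.Int[OF BN H]])
    also have "\<dots> = (\<integral>\<^sup>+x. emeasure (noise_law a \<sigma> k) {y \<in> space (noise_law a \<sigma> k).
         x(k := y) \<in> shear -` ({x \<in> space observation. x k \<in> B} \<inter> H) \<inter> space noise_row} \<partial>noise_row)"
      using emeasure_PiM_resample[OF prob_noise finite_V k(1) sub] by (simp only: noise_row_def)
    also have "\<dots> = (\<integral>\<^sup>+x. emeasure (noise_law a \<sigma> k) B * indicator (shear -` H \<inter> space noise_row) x \<partial>noise_row)"
    proof (rule nn_integral_cong)
      fix x assume x: "x \<in> space noise_row"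
      have "{y \<in> space (noise_law a \<sigma> k). x(k := y) \<in> shear -` ({x \<in> space observation. x k \<in> B} \<inter> H) \<inter> space noise_row} =
          (if shear x \<in> H then B else {})"
        using x ins[OF x] ext[OF x] TN by (auto simp: Tk)
      then show "emeasure (noise_law a \<sigma> k) {y \<in> space (noise_law a \<sigma> k).
           x(k := y) \<in> shear -` ({x \<in> space observation. x k \<in> B} \<inter> H) \<inter> space noise_row} =
          emeasure (noise_law a \<sigma> k) B * indicator (shear -` H \<inter> space noise_row) x"
        using x by (simp add: indicator_def)
    qed
    also have "\<dots> = emeasure (noise_law a \<sigma> k) B * emeasure noise_row (shear -` H \<inter> space noise_row)"
      using measurable_sets[OF TQN H] by (rule nn_integral_cmult_indicator)
    finally show ?thesis by (simp only: emN[OF H])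
  qed
  have "emeasure observation {x \<in> space observation. x k \<in> B} = emeasure (noise_law a \<sigma> k) B"
    using key[OF sets.top] TN ext by (simp add: Int_absorb2 observation.emeasure_space_1)
  then have "emeasure observation ({x \<in> space observation. x k \<in> B} \<inter> G) = emeasure observation {x \<in> space observation. x k \<in> B} * emeasure observation G"
    using key[OF G ins] by simp
  then show ?thesis
    by (simp add: observation.emeasure_eq_measure ennreal_mult[symmetric])
qed

lemma subalgebra_coord:
  assumes "J \<subseteq> V"
  shows "subalgebra observation (coord_algebra observation J)"
    and "\<And>G. G \<in> sets (coord_algebra observation J) \<Longrightarrow>
      \<exists>A. G = {x \<in> space observation. restrict x J \<in> A}"
proof -
  have m: "(\<lambda>x. restrict x J) \<in> measurable observation (PiM J (\<lambda>_. borel :: real measure))"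
    using measurable_restrict_subset[OF assms, of "\<lambda>_. borel"]
    by (simp add: measurable_cong_sets[OF sets_observation refl])
  have eq: "sets (coord_algebra observation J) =
      {(\<lambda>x. restrict x J) -` A \<inter> space observation |A. A \<in> sets (PiM J (\<lambda>_. borel :: real measure))}"
    unfolding coord_algebra_def using measurable_space[OF m] by (intro sets_vimage_algebra2) auto
  show "subalgebra observation (coord_algebra observation J)"
    unfolding subalgebra_def eq using measurable_sets[OF m] by (auto simp: coord_algebra_def)
  show "\<exists>A. G = {x \<in> space observation. restrict x J \<in> A}" if "G \<in> sets (coord_algebra observation J)" for G
    using that unfolding eq by blast
qed

lemma coord_algebra_insensitive:
  assumes k: "k \<in> V" "k \<noteq> a" and G: "G \<in> sets (coord_algebra observation (V - {a, k}))" and x: "x \<in> space noise_row"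
  shows "shear (x(k := y)) \<in> G \<longleftrightarrow> shear x \<in> G"
proof -
  obtain A where A: "G = {x \<in> space observation. restrict x (V - {a, k}) \<in> A}"
    using subalgebra_coord(2)[OF _ G] by blast
  have "restrict (shear (x(k := y))) (V - {a, k}) = restrict (shear x) (V - {a, k})"
    by (rule ext) (auto simp: shear_def restrict_def)
  moreover have "shear x \<in> space observation" "shear (x(k := y)) \<in> space observation"
    using x k aV by (auto simp: space_noise_row space_observation shear_def)
  ultimately show ?thesis by (simp add: A)
qed

lemma sets_coord: "k \<in> V \<Longrightarrow> B \<in> sets borel \<Longrightarrow> {x \<in> space observation. x k \<in> B} \<in> sets observation"
  using measurable_sets[OF measurable_coord(1), of k B] by (simp add: vimage_def Int_def conj_commute)

lemma integrable_coord_indicator: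
  assumes "k \<in> V" "B \<in> sets borel"
  shows "integrable observation (\<lambda>x. indicator B (x k) :: real)"
proof -
  interpret observation: prob_space observation by (rule prob_observation)
  show ?thesis
    using measurable_coord(1)[OF assms(1)] assms(2)
    by (intro observation.integrable_const_bound[where B = 1]) (auto split: split_indicator)
qed

lemma integrable_coord_indicator2:
  assumes "k \<in> V" "B \<in> sets borel" "j \<in> V" "A \<in> sets borel"
  shows "integrable observation (\<lambda>x. indicator A (x j) * indicator B (x k) :: real)"
proof -
  interpret observation: prob_space observation by (rule prob_observation)
  show ?thesis
    using measurable_coord(1)[OF assms(1)] measurable_coord(1)[OF assms(3)] assms(2,4)
    by (intro observation.integrable_const_bound[where B = 1]) (auto split: split_indicator)
qed

text \<open>Coordinate \<open>k\<close> is independent of the coordinates other than \<open>a\<close> and \<open>k\<close>, even for \<open>k = b\<close>.\<close>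

lemma cond_exp_coord:
  assumes k: "k \<in> V" "k \<noteq> a" and B: "B \<in> sets borel"
  shows "AE x in observation. real_cond_exp observation (coord_algebra observation (V - {a, k})) (\<lambda>x. indicator B (x k)) x =
    measure observation {x \<in> space observation. x k \<in> B}"
proof -
  interpret observation: prob_space observation by (rule prob_observation)
  let ?F = "coord_algebra observation (V - {a, k})"
  interpret F: finite_measure_subalgebra observation ?F
    by unfold_locales (rule subalgebra_coord, blast)
  show ?thesis
  proof (rule F.real_cond_exp_charact)
    fix G assume G: "G \<in> sets ?F"
    have GN: "G \<in> sets observation" using G F.subalg by (auto simp: subalgebra_def)
    have "(LINT x:G|observation. indicator B (x k) :: real) = (LINT x|observation. indicator ({x \<in> space observation. x k \<in> B} \<inter> G) x)"
      unfolding set_lebesgue_integral_def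
      by (intro Bochner_Integration.integral_cong) (auto split: split_indicator)
    also have "\<dots> = measure observation ({x \<in> space observation. x k \<in> B} \<inter> G)"
      using sets.sets_into_space[OF GN] by (simp add: Int_absorb2 Int_absorb1 le_infI2)
    also have "\<dots> = measure observation {x \<in> space observation. x k \<in> B} * measure observation G"
      by (rule measure_indep_coord[OF k B GN coord_algebra_insensitive[OF k G]])
    also have "\<dots> = (LINT x:G|observation. measure observation {x \<in> space observation. x k \<in> B})"
      using sets.sets_into_space[OF GN] by (simp add: set_lebesgue_integral_def Int_absorb2)
    finally show "(LINT x:G|observation. indicator B (x k) :: real) = (LINT x:G|observation. measure observation {x \<in> space observation. x k \<in> B})" .
  qed (use integrable_coord_indicator[OF k(1) B] in auto)
qed

lemma cond_indep_other:
  assumes k: "k \<in> V" "k \<noteq> a" "k \<noteq> b"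
  shows "cond_indep_rv observation (coord_algebra observation (V - {a, k})) (\<lambda>x. x a) (\<lambda>x. x k)"
  unfolding cond_indep_rv_def
proof (intro ballI)
  fix A B :: "real set" assume A: "A \<in> sets borel" and B: "B \<in> sets borel"
  interpret observation: prob_space observation by (rule prob_observation)
  let ?F = "coord_algebra observation (V - {a, k})"
  interpret F: finite_measure_subalgebra observation ?F
    by unfold_locales (rule subalgebra_coord, blast)
  let ?p = "measure observation {x \<in> space observation. x k \<in> B}"
  let ?E = "real_cond_exp observation ?F (\<lambda>x. indicator A (x a))"
  have iA: "integrable observation (\<lambda>x. indicator A (x a) :: real)"
    by (rule integrable_coord_indicator[OF aV A])
  have "AE x in observation. real_cond_exp observation ?F (\<lambda>x. indicator A (x a) * indicator B (x k)) x = ?E x * ?p"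
  proof (rule F.real_cond_exp_charact)
    fix G assume G: "G \<in> sets ?F"
    have GN: "G \<in> sets observation" using G F.subalg by (auto simp: subalgebra_def)
    have AN: "{x \<in> space observation. x a \<in> A} \<in> sets observation" by (rule sets_coord[OF aV A])
    let ?H = "{x \<in> space observation. x a \<in> A} \<inter> G"
    have "(LINT x:G|observation. indicator A (x a) * indicator B (x k) :: real) =
        (LINT x|observation. indicator ({x \<in> space observation. x k \<in> B} \<inter> ?H) x)"
      unfolding set_lebesgue_integral_def
      by (intro Bochner_Integration.integral_cong) (auto split: split_indicator)
    also have "\<dots> = measure observation ({x \<in> space observation. x k \<in> B} \<inter> ?H)"
      by (simp add: Int_absorb2 le_infI1)
    also have "\<dots> = ?p * measure observation ?H"
    proof (rule measure_indep_coord[OF k(1,2) B])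
      show "?H \<in> sets observation" using AN GN by blast
      fix x :: "nat \<Rightarrow> real" and y assume x: "x \<in> space noise_row"
      have "shear (x(k := y)) \<in> space observation \<and> shear x \<in> space observation"
        using x k aV by (auto simp: space_noise_row space_observation shear_def)
      moreover have "shear (x(k := y)) a = shear x a" using k ab by (simp add: shear_def)
      ultimately show "shear (x(k := y)) \<in> ?H \<longleftrightarrow> shear x \<in> ?H"
        using coord_algebra_insensitive[OF k(1,2) G x] by simp
    qed
    also have "measure observation ?H = (LINT x:G|observation. indicator A (x a) :: real)"
    proof -
      have "(LINT x:G|observation. indicator A (x a) :: real) = (LINT x|observation. indicator ?H x)"
        unfolding set_lebesgue_integral_def
        by (intro Bochner_Integration.integral_cong) (auto split: split_indicator)
      then show ?thesis by (simp add: Int_absorb2 le_infI1)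
    qed
    also have "\<dots> = (LINT x:G|observation. ?E x)"
      by (rule F.real_cond_exp_intA[OF iA G])
    finally show "(LINT x:G|observation. indicator A (x a) * indicator B (x k) :: real) = (LINT x:G|observation. ?E x * ?p)"
      by (simp add: mult.commute)
  next
    show "integrable observation (\<lambda>x. ?E x * ?p)"
      using F.real_cond_exp_int(1)[OF iA] by simp
    show "(\<lambda>x. ?E x * ?p) \<in> borel_measurable ?F" by measurable
  qed (rule integrable_coord_indicator2[OF k(1) B aV A])
  then show "AE x in observation. real_cond_exp observation ?F (\<lambda>x. indicator A (x a) * indicator B (x k)) x =
      ?E x * real_cond_exp observation ?F (\<lambda>x. indicator B (x k)) x"
    using cond_exp_coord[OF k(1,2) B] by eventually_elim simp
qed

text \<open>The covariance of the pair comes from the risk formula by polarization.\<close>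

lemma integral_product_pair: "has_bochner_integral observation (\<lambda>x. x a * x b) s"
proof -
  have e: "has_bochner_integral observation (\<lambda>x. (x a - t * x b)\<^sup>2) ((1 - s\<^sup>2) + (t - s)\<^sup>2)" for t
  proof -
    let ?\<theta> = "\<lambda>k. if k = b then t else 0"
    have "(\<Sum>k\<in>V. ?\<theta> k * x k) = t * x b" for x :: "nat \<Rightarrow> real"
      using finite_V bV by (simp add: if_distrib[of "\<lambda>c. c * _"] sum.delta cong: if_cong)
    then show ?thesis using prediction_error_moment[of ?\<theta>] ab by simp
  qed
  have "has_bochner_integral observation (\<lambda>x. ((x a - (-1) * x b)\<^sup>2 - (x a - 1 * x b)\<^sup>2) / 4)
      ((((1 - s\<^sup>2) + (-1 - s)\<^sup>2) - ((1 - s\<^sup>2) + (1 - s)\<^sup>2)) / 4)"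
    by (intro has_bochner_integral_divide has_bochner_integral_diff e)
  also have "(\<lambda>x. ((x a - (-1) * x b)\<^sup>2 - (x a - 1 * x b)\<^sup>2) / 4) = (\<lambda>x::nat \<Rightarrow> real. x a * x b)"
    by (rule ext) (simp add: power2_eq_square algebra_simps)
  finally show ?thesis by (simp add: power2_eq_square algebra_simps)
qed

text \<open>Since \<open>x b\<close> is independent of the conditioning coordinates, conditional independence of \<open>x a\<close> and \<open>x b\<close> would
  integrate to plain independence, and their covariance would be zero instead of \<open>s\<close>.\<close>

lemma not_cond_indep_pair:
  "\<not> cond_indep_rv observation (coord_algebra observation (V - {a, b})) (\<lambda>x. x a) (\<lambda>x. x b)"
proof
  assume ci: "cond_indep_rv observation (coord_algebra observation (V - {a, b})) (\<lambda>x. x a) (\<lambda>x. x b)"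
  interpret observation: prob_space observation by (rule prob_observation)
  let ?F = "coord_algebra observation (V - {a, b})"
  interpret F: finite_measure_subalgebra observation ?F
    by unfold_locales (rule subalgebra_coord, blast)
  have prod: "measure observation ({x \<in> space observation. x a \<in> A} \<inter> {x \<in> space observation. x b \<in> B}) =
      measure observation {x \<in> space observation. x a \<in> A} * measure observation {x \<in> space observation. x b \<in> B}"
    if A: "A \<in> sets borel" and B: "B \<in> sets borel" for A B
  proof -
    let ?p = "measure observation {x \<in> space observation. x b \<in> B}"
    let ?f = "\<lambda>x. indicator A (x a) * indicator B (x b) :: real"
    let ?g = "\<lambda>x. indicator A (x a) :: real"
    have f: "integrable observation ?f" by (rule integrable_coord_indicator2[OF bV B aV A])
    have g: "integrable observation ?g" by (rule integrable_coord_indicator[OF aV A])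
    have "(LINT x|observation. ?f x) = (LINT x|observation. real_cond_exp observation ?F ?f x)"
      by (rule F.real_cond_exp_int(2)[OF f, symmetric])
    also have "\<dots> = (LINT x|observation. real_cond_exp observation ?F ?g x * ?p)"
    proof (rule integral_cong_AE)
      have "AE x in observation. real_cond_exp observation ?F ?f x =
          real_cond_exp observation ?F ?g x * real_cond_exp observation ?F (\<lambda>x. indicator B (x b)) x"
        using ci A B by (simp add: cond_indep_rv_def)
      then show "AE x in observation. real_cond_exp observation ?F ?f x = real_cond_exp observation ?F ?g x * ?p"
        using cond_exp_coord[OF bV ab[symmetric] B] by eventually_elim simp
    qed (use F.real_cond_exp_int(1)[OF f] F.real_cond_exp_int(1)[OF g] in auto)
    also have "\<dots> = (LINT x|observation. ?g x) * ?p"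
      using F.real_cond_exp_int[OF g] by simp
    finally have *: "(LINT x|observation. ?f x) = (LINT x|observation. ?g x) * ?p" .
    have "(LINT x|observation. ?f x) = (LINT x|observation. indicator ({x \<in> space observation. x a \<in> A} \<inter> {x \<in> space observation. x b \<in> B}) x)"
      by (intro Bochner_Integration.integral_cong) (auto split: split_indicator)
    also have "\<dots> = measure observation ({x \<in> space observation. x a \<in> A} \<inter> {x \<in> space observation. x b \<in> B})"
      by (simp add: Int_absorb2 le_infI1)
    finally have 1: "(LINT x|observation. ?f x) = \<dots>" .
    have "(LINT x|observation. ?g x) = (LINT x|observation. indicator {x \<in> space observation. x a \<in> A} x)"
      by (intro Bochner_Integration.integral_cong) (auto split: split_indicator)
    also have "\<dots> = measure observation {x \<in> space observation. x a \<in> A}"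
      by (simp add: Int_absorb2)
    finally show ?thesis using * 1 by simp
  qed
  have rv: "(\<lambda>x. x a) \<in> borel_measurable observation" "(\<lambda>x. x b) \<in> borel_measurable observation"
    using measurable_coord(1) aV bV by auto
  have "distr observation borel (\<lambda>x. x a) \<Otimes>\<^sub>M distr observation borel (\<lambda>x. x b) =
      distr observation (borel \<Otimes>\<^sub>M borel) (\<lambda>x. (x a, x b))"
  proof (rule pair_measure_eqI)
    fix A B assume "A \<in> sets (distr observation borel (\<lambda>x. x a))" "B \<in> sets (distr observation borel (\<lambda>x. x b))"
    then have AB: "A \<in> sets borel" "B \<in> sets borel" by auto
    have "emeasure (distr observation (borel \<Otimes>\<^sub>M borel) (\<lambda>x. (x a, x b))) (A \<times> B) =
        emeasure observation ({x \<in> space observation. x a \<in> A} \<inter> {x \<in> space observation. x b \<in> B})"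
      using AB rv by (subst emeasure_distr) (auto intro!: arg_cong[where f = "emeasure observation"])
    moreover have "emeasure (distr observation borel (\<lambda>x. x a)) A = emeasure observation {x \<in> space observation. x a \<in> A}"
      using AB rv by (subst emeasure_distr) (auto intro!: arg_cong[where f = "emeasure observation"])
    moreover have "emeasure (distr observation borel (\<lambda>x. x b)) B = emeasure observation {x \<in> space observation. x b \<in> B}"
      using AB rv by (subst emeasure_distr) (auto intro!: arg_cong[where f = "emeasure observation"])
    ultimately show "emeasure (distr observation borel (\<lambda>x. x a)) A * emeasure (distr observation borel (\<lambda>x. x b)) B =
        emeasure (distr observation (borel \<Otimes>\<^sub>M borel) (\<lambda>x. (x a, x b))) (A \<times> B)"
      using prod[OF AB] by (simp add: observation.emeasure_eq_measure ennreal_mult[symmetric])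
  qed (use rv in \<open>auto intro!: prob_space_imp_sigma_finite observation.prob_space_distr sets_pair_measure_cong\<close>)
  then have ind: "observation.indep_var borel (\<lambda>x. x a) borel (\<lambda>x. x b)"
    using rv by (simp add: observation.indep_var_distribution_eq)
  have Qa: "has_bochner_integral noise_row (\<lambda>x. x a + s * x b) (0 + s * 0)"
    using has_mean_zero aV bV by (intro has_bochner_integral_add has_bochner_integral_mult_right) auto
  have ia: "integrable observation (\<lambda>x. x a)"
    using Qa rv unfolding observation_def
    by (subst integrable_distr_eq[OF measurable_shear])
      (auto simp: has_bochner_integral_iff shear_def measurable_cong_sets[OF sets_observation refl] aV)
  have ib: "integrable observation (\<lambda>x. x b)" "(LINT x|observation. x b) = 0"
    using has_mean_zero[OF bV] ab bV unfolding observation_def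
    by (auto simp: has_bochner_integral_iff shear_def integrable_distr_eq[OF measurable_shear]
        integral_distr[OF measurable_shear])
  have "(LINT x|observation. x a * x b) = (LINT x|observation. x a) * (LINT x|observation. x b)"
    by (rule observation.indep_var_lebesgue_integral[OF ind ia ib(1)])
  then show False
    using ib(2) integral_product_pair s by (simp add: has_bochner_integral_iff)
qed

end

lemma neighborhood_pair:
  assumes ab: "a \<in> {1..p}" "b \<in> {1..p}" "a \<noteq> b" and s: "0 < s" "s < 1"
    and S: "\<And>i j. i \<in> {1..p} \<Longrightarrow> j \<in> {1..p} \<Longrightarrow> S i j = pair_mat a b 1 s i j"
    and pr: "prob_space (mvn p S)"
  shows "neighborhood p S a = {b}"
proof -
  note mvn_eq = mvn_eq_distr_noise[OF ab s S pr]
  interpret gaussian_pair "{1..p}" a b s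
    by unfold_locales (use ab s in auto)
  have observation: "mvn p S = observation"
    unfolding observation_def noise_row_def \<sigma>_def shear_def[abs_def] by (rule mvn_eq)
  show ?thesis
    unfolding neighborhood_def observation using not_cond_indep_pair cond_indep_other ab bV by auto
qed

lemma prediction_risk_pair:
  assumes ab: "a \<in> {1..p}" "b \<in> {1..p}" "a \<noteq> b" and s: "0 < s" "s < 1"
    and S: "\<And>i j. i \<in> {1..p} \<Longrightarrow> j \<in> {1..p} \<Longrightarrow> S i j = pair_mat a b 1 s i j"
    and pr: "prob_space (mvn p S)" and \<theta>: "\<theta> a = 0"
  shows "prediction_risk p S a \<theta> = (1 - s\<^sup>2) + (\<theta> b - s)\<^sup>2 + (\<Sum>k\<in>{1..p} - {a, b}. (\<theta> k)\<^sup>2)"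
proof -
  note mvn_eq = mvn_eq_distr_noise[OF ab s S pr]
  interpret gaussian_pair "{1..p}" a b s
    by unfold_locales (use ab s in auto)
  have observation: "mvn p S = observation"
    unfolding observation_def noise_row_def \<sigma>_def shear_def[abs_def] by (rule mvn_eq)
  show ?thesis
    unfolding prediction_risk_def observation
    using prediction_error_moment[of \<theta>, OF \<theta>] by (simp only: has_bochner_integral_iff)
qed

section \<open>Most designs are good\<close>

context gaussian_pair
begin

text \<open>Column \<open>a\<close> of such a matrix is the noise \<open>w\<close> of the regression of node \<open>a\<close> on node \<open>b\<close>, not an
  observation of node \<open>a\<close>.\<close>

definition noise_sample :: "nat \<Rightarrow> (nat \<Rightarrow> nat \<Rightarrow> real) measure" where
  "noise_sample n = PiM {1..n} (\<lambda>_. noise_row)"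

abbreviation cp :: "nat \<Rightarrow> (nat \<Rightarrow> nat \<Rightarrow> real) \<Rightarrow> nat \<Rightarrow> nat \<Rightarrow> real" where
  "cp n U j k \<equiv> ip n (\<lambda>i. U i j) (\<lambda>i. U i k)"

lemma prob_noise_sample: "prob_space (noise_sample n)"
  unfolding noise_sample_def by (rule prob_space_PiM) (rule prob_noise_row)

lemma measurable_entry [measurable]:
  "i \<in> {1..n} \<Longrightarrow> k \<in> V \<Longrightarrow> (\<lambda>U. U i k) \<in> borel_measurable (noise_sample n)"
  using measurable_compose[of "\<lambda>U. U i" "noise_sample n" noise_row "\<lambda>x. x k" borel]
  by (simp add: noise_sample_def measurable_component_singleton measurable_coord(2))

lemma measurable_cp [measurable]:
  "j \<in> V \<Longrightarrow> k \<in> V \<Longrightarrow> (\<lambda>U. cp n U j k) \<in> borel_measurable (noise_sample n)"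
  unfolding ip_def by (intro borel_measurable_sum borel_measurable_times measurable_entry) auto

lemma pred_eq_real [measurable]:
  fixes f g :: "_ \<Rightarrow> real"
  shows "f \<in> borel_measurable M \<Longrightarrow> g \<in> borel_measurable M \<Longrightarrow> Measurable.pred M (\<lambda>x. f x = g x)"
  by (simp add: pred_def borel_measurable_eq)

lemma AE_unique_entry:
  assumes "i \<in> {1..n}" "k \<in> V" and P: "{U \<in> space (noise_sample n). P U} \<in> sets (noise_sample n)"
    and uniq: "\<And>U y z. P (U(i := (U i)(k := y))) \<Longrightarrow> P (U(i := (U i)(k := z))) \<Longrightarrow> y = z"
  shows "AE U in noise_sample n. \<not> P U"
  unfolding noise_sample_def noise_row_def
  by (rule AE_PiM_PiM_unique_entry[OF prob_noise _ finite_V assms(1,2) noise_law_atomless _ uniq])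
    (use P in \<open>simp_all add: noise_sample_def noise_row_def\<close>)

text \<open>Every tie below is an equation that is affine in one column; it has probability zero as soon as one
  coefficient is nonzero.\<close>

lemma AE_affine_column:
  assumes i: "i \<in> {1..n}" and j: "j \<in> V"
    and v: "\<And>U y. v (U(i := (U i)(j := y))) = v U" and g: "\<And>U y. g (U(i := (U i)(j := y))) = g U"
    and P: "{U \<in> space (noise_sample n). v U i \<noteq> 0 \<and> ip n (\<lambda>i. U i j) (v U) = g U} \<in> sets (noise_sample n)"
  shows "AE U in noise_sample n. v U i \<noteq> 0 \<longrightarrow> ip n (\<lambda>i. U i j) (v U) \<noteq> g U"
proof -
  have "AE U in noise_sample n. \<not> (v U i \<noteq> 0 \<and> ip n (\<lambda>i. U i j) (v U) = g U)"
  proof (rule AE_unique_entry[OF i j P])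
    fix U :: "nat \<Rightarrow> nat \<Rightarrow> real" and y z
    have "ip n (\<lambda>m. (U(i := (U i)(j := x))) m j) (v U) = x * v U i + (\<Sum>m\<in>{1..n} - {i}. U m j * v U m)" for x
      unfolding ip_def using i by (subst sum.remove[of _ i]) (auto intro!: sum.cong)
    note col = this
    assume "v (U(i := (U i)(j := y))) i \<noteq> 0 \<and>
        ip n (\<lambda>m. (U(i := (U i)(j := y))) m j) (v (U(i := (U i)(j := y)))) = g (U(i := (U i)(j := y)))"
      "v (U(i := (U i)(j := z))) i \<noteq> 0 \<and>
        ip n (\<lambda>m. (U(i := (U i)(j := z))) m j) (v (U(i := (U i)(j := z)))) = g (U(i := (U i)(j := z)))"
    then have "v U i \<noteq> 0" "y * v U i = z * v U i"
      unfolding v g col by linarith+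
    then show "y = z" by simp
  qed
  then show ?thesis by (rule eventually_mono) blast
qed

lemma AE_entry_nonzero:
  assumes "i \<in> {1..n}" "k \<in> V"
  shows "AE U in noise_sample n. U i k \<noteq> 0"
  by (rule AE_unique_entry[OF assms]) (use measurable_entry[OF assms] in \<open>auto\<close>)

lemma AE_no_score_tie:
  assumes n: "n \<ge> 1" and jk: "j \<in> V - {a}" "k \<in> V - {a}" "j \<noteq> k"
  shows "AE U in noise_sample n. cp n U j a \<noteq> cp n U k a"
proof -
  have 1: "1 \<in> {1..n}" using n by simp
  have "AE U in noise_sample n. U 1 a \<noteq> 0 \<longrightarrow> cp n U j a \<noteq> cp n U k a"
  proof (rule AE_affine_column[OF 1, where v = "\<lambda>U i. U i a" and g = "\<lambda>U. cp n U k a"])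
    show "{U \<in> space (noise_sample n). U 1 a \<noteq> 0 \<and> cp n U j a = cp n U k a} \<in> sets (noise_sample n)"
      using measurable_entry[OF 1 aV] jk aV
      by (intro sets.sets_Collect_conj borel_measurable_eq borel_measurable_neq measurable_cp) auto
  qed (use jk in \<open>auto simp: fun_eq_iff intro!: arg_cong2[where f = "ip n"]\<close>)
  with AE_entry_nonzero[OF 1 aV] show ?thesis by eventually_elim blast
qed

lemma AE_rows_not_proportional:
  assumes n: "n \<ge> 2"
  shows "AE U in noise_sample n. U 1 a * U 2 b \<noteq> U 2 a * U 1 b"
proof -
  have 1: "1 \<in> {1..n}" "2 \<in> {1..n}" using n by auto
  have "AE U in noise_sample n. \<not> (U 2 b \<noteq> 0 \<and> U 1 a * U 2 b = U 2 a * U 1 b)"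
  proof (rule AE_unique_entry[OF 1(1) aV])
    show "{U \<in> space (noise_sample n). U 2 b \<noteq> 0 \<and> U 1 a * U 2 b = U 2 a * U 1 b} \<in> sets (noise_sample n)"
      using 1 aV bV
      by (intro sets.sets_Collect_conj borel_measurable_eq borel_measurable_neq
          borel_measurable_times measurable_entry borel_measurable_const)
    fix U :: "nat \<Rightarrow> nat \<Rightarrow> real" and y z
    assume "(U(1 := (U 1)(a := y))) 2 b \<noteq> 0 \<and> (U(1 := (U 1)(a := y))) 1 a * (U(1 := (U 1)(a := y))) 2 b =
        (U(1 := (U 1)(a := y))) 2 a * (U(1 := (U 1)(a := y))) 1 b"
      "(U(1 := (U 1)(a := z))) 2 b \<noteq> 0 \<and> (U(1 := (U 1)(a := z))) 1 a * (U(1 := (U 1)(a := z))) 2 b =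
        (U(1 := (U 1)(a := z))) 2 a * (U(1 := (U 1)(a := z))) 1 b"
    then have "U 2 b \<noteq> 0" "y * U 2 b = z * U 2 b" using ab by auto
    then show "y = z" by simp
  qed
  with AE_entry_nonzero[OF 1(2) bV] show ?thesis by eventually_elim blast
qed

text \<open>With \<open>\<alpha> = \<langle>x\<^sub>j - \<eta> z, w\<rangle>\<close> and \<open>\<kappa> = \<langle>x\<^sub>j - \<eta> z, z\<rangle>\<close> the equation reads \<open>\<langle>x\<^sub>k - \<epsilon> z, \<alpha> z - \<kappa> w\<rangle> = 0\<close>, so it
  is affine in column \<open>k\<close>. Its coefficient vector \<open>\<alpha> z - \<kappa> w\<close> cannot vanish in both of the first two rows, because
  \<open>w\<close> and \<open>z\<close> are not proportional there.\<close>

lemma AE_no_double_tie: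
  assumes n: "n \<ge> 2" and jk: "j \<in> V - {a, b}" "k \<in> V - {a, b}" "j \<noteq> k"
  shows "AE U in noise_sample n. cp n U j b - \<eta> * cp n U b b \<noteq> 0 \<longrightarrow>
    (cp n U j a - \<eta> * cp n U b a) * (cp n U k b - \<epsilon> * cp n U b b) \<noteq>
    (cp n U k a - \<epsilon> * cp n U b a) * (cp n U j b - \<eta> * cp n U b b)"
proof -
  define \<alpha> where "\<alpha> = (\<lambda>U. cp n U j a - \<eta> * cp n U b a)"
  define \<kappa> where "\<kappa> = (\<lambda>U. cp n U j b - \<eta> * cp n U b b)"
  define v where "v = (\<lambda>U i. \<alpha> U * U i b - \<kappa> U * U i a)"
  define g where "g = (\<lambda>U. \<epsilon> * (\<alpha> U * cp n U b b - \<kappa> U * cp n U b a))"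
  have V: "j \<in> V" "k \<in> V" using jk by auto
  have [measurable]: "\<alpha> \<in> borel_measurable (noise_sample n)" "\<kappa> \<in> borel_measurable (noise_sample n)" "g \<in> borel_measurable (noise_sample n)"
    unfolding \<alpha>_def \<kappa>_def g_def using V aV bV by measurable
  have ipv: "ip n (\<lambda>i. U i k) (v U) = \<alpha> U * cp n U k b - \<kappa> U * cp n U k a" for U
    unfolding v_def by (simp only: ip_linear)
  have nz: "AE U in noise_sample n. v U i \<noteq> 0 \<longrightarrow> ip n (\<lambda>i. U i k) (v U) \<noteq> g U" if i: "i \<in> {1..n}" for i
  proof (rule AE_affine_column[OF i V(2)])
    fix U :: "nat \<Rightarrow> nat \<Rightarrow> real" and y
    let ?U = "U(i := (U i)(k := y))"
    have ne: "j \<noteq> k" "a \<noteq> k" "b \<noteq> k" using jk by auto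
    have e: "?U m l = U m l" if "l \<noteq> k" for m l
      using that by simp
    note es = e[OF ne(1)] e[OF ne(2)] e[OF ne(3)]
    have "\<alpha> ?U = \<alpha> U" "\<kappa> ?U = \<kappa> U" unfolding \<alpha>_def \<kappa>_def by (simp_all only: es)
    then show "v ?U = v U" "g ?U = g U" unfolding v_def g_def by (simp_all only: es)
  next
    show "{U \<in> space (noise_sample n). v U i \<noteq> 0 \<and> ip n (\<lambda>i. U i k) (v U) = g U} \<in> sets (noise_sample n)"
      unfolding ipv unfolding v_def using i V aV bV by measurable
  qed
  have 1: "1 \<in> {1..n}" "2 \<in> {1..n}" using n by auto
  from nz[OF 1(1)] nz[OF 1(2)] AE_rows_not_proportional[OF n] show ?thesis
  proof eventually_elim
    case (elim U)
    show ?case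
    proof (intro impI notI)
      assume "cp n U j b - \<eta> * cp n U b b \<noteq> 0"
      then have \<kappa>: "\<kappa> U \<noteq> 0" by (simp add: \<kappa>_def)
      assume "(cp n U j a - \<eta> * cp n U b a) * (cp n U k b - \<epsilon> * cp n U b b) =
        (cp n U k a - \<epsilon> * cp n U b a) * (cp n U j b - \<eta> * cp n U b b)"
      then have "\<alpha> U * (cp n U k b - \<epsilon> * cp n U b b) = (cp n U k a - \<epsilon> * cp n U b a) * \<kappa> U"
        by (simp only: \<alpha>_def \<kappa>_def)
      then have "ip n (\<lambda>i. U i k) (v U) = g U"
        unfolding ipv g_def by (simp add: algebra_simps)
      then have v0: "\<alpha> U * U 1 b = \<kappa> U * U 1 a" "\<alpha> U * U 2 b = \<kappa> U * U 2 a"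
        using elim(1,2) by (simp_all add: v_def)
      have "\<kappa> U * (U 1 a * U 2 b) = (\<alpha> U * U 1 b) * U 2 b" by (simp only: v0(1) mult.assoc)
      also have "\<dots> = (\<alpha> U * U 2 b) * U 1 b" by simp
      also have "\<dots> = \<kappa> U * (U 2 a * U 1 b)" by (simp only: v0(2) mult.assoc)
      finally show False using elim(3) \<kappa> by simp
    qed
  qed
qed

lemma mgf_cross:
  assumes jk: "j \<in> V - {a}" "k \<in> V - {a}" "j \<noteq> k" and \<eta>: "\<eta> \<in> {-1, 1}"
  shows "(\<integral>\<^sup>+x. ennreal (exp (\<eta> * x j * x k - (x k)\<^sup>2)) \<partial>noise_row) = ennreal (1 / sqrt 2)"
proof -
  interpret noise_row: prob_space noise_row by (rule prob_noise_row)
  have \<eta>2: "\<eta>\<^sup>2 = 1" using \<eta> by auto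
  have V: "j \<in> V" "k \<in> V" and na: "j \<noteq> a" "k \<noteq> a" using jk by auto
  have m1: "(\<lambda>x. ennreal (exp (\<eta> * x j * x k - (x k)\<^sup>2))) \<in> borel_measurable (PiM V (noise_law a \<sigma>))"
    and m2: "(\<lambda>x. ennreal (exp (- (x k)\<^sup>2 / 2))) \<in> borel_measurable (PiM V (noise_law a \<sigma>))"
    unfolding noise_row_def[symmetric] using measurable_coord(2)[OF V(1)] measurable_coord(2)[OF V(2)] by auto
  have "(\<integral>\<^sup>+x. ennreal (exp (\<eta> * x j * x k - (x k)\<^sup>2)) \<partial>noise_row) =
      (\<integral>\<^sup>+x. (\<integral>\<^sup>+y. ennreal (exp (\<eta> * (x(j := y)) j * (x(j := y)) k - ((x(j := y)) k)\<^sup>2)) \<partial>noise_law a \<sigma> j) \<partial>noise_row)"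
    unfolding noise_row_def by (rule nn_integral_PiM_resample[OF prob_noise finite_V V(1) m1])
  also have "\<dots> = (\<integral>\<^sup>+x. ennreal (exp (- (x k)\<^sup>2 / 2)) \<partial>noise_row)"
    using na jk(3) normal_mgf_cross[OF \<eta>2] by (intro nn_integral_cong) (simp add: noise_law_def)
  also have "\<dots> = (\<integral>\<^sup>+x. (\<integral>\<^sup>+y. ennreal (exp (- ((x(k := y)) k)\<^sup>2 / 2)) \<partial>noise_law a \<sigma> k) \<partial>noise_row)"
    unfolding noise_row_def by (rule nn_integral_PiM_resample[OF prob_noise finite_V V(2) m2])
  also have "\<dots> = (\<integral>\<^sup>+x. ennreal (1 / sqrt 2) \<partial>noise_row)"
    using na normal_mgf_square by (intro nn_integral_cong) (simp add: noise_law_def)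
  also have "\<dots> = ennreal (1 / sqrt 2)" by (simp add: noise_row.emeasure_space_1)
  finally show ?thesis .
qed

text \<open>The bound is exponentially small in \<open>n\<close>, so that it survives a union over polynomially many columns.\<close>

lemma prob_correlated_le:
  assumes jk: "j \<in> V - {a}" "k \<in> V - {a}" "j \<noteq> k" and \<eta>: "\<eta> \<in> {-1, 1}"
  shows "measure (noise_sample n) {U \<in> space (noise_sample n). \<eta> * cp n U j k \<ge> cp n U k k} \<le> (1 / sqrt 2) ^ n"
proof -
  have V: "j \<in> V" "k \<in> V" using jk by auto
  have e: "(\<Sum>i\<in>{1..n}. \<eta> * U i j * U i k - (U i k)\<^sup>2) = \<eta> * cp n U j k - cp n U k k" for U
    by (simp add: ip_def sum_subtractf sum_distrib_left power2_eq_square mult.assoc)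
  have "measure (noise_sample n) {U \<in> space (noise_sample n). 0 \<le> (\<Sum>i\<in>{1..n}. \<eta> * U i j * U i k - (U i k)\<^sup>2)} \<le> (1 / sqrt 2) ^ card {1..n}"
    unfolding noise_sample_def
  proof (rule measure_PiM_sum_nonneg_le[OF prob_noise_row])
    show "(\<lambda>x. \<eta> * x j * x k - (x k)\<^sup>2) \<in> borel_measurable noise_row"
      using measurable_coord(2)[OF V(1)] measurable_coord(2)[OF V(2)] by auto
  qed (use mgf_cross[OF assms] in auto)
  then show ?thesis unfolding e by simp
qed

definition swap_col :: "nat \<Rightarrow> nat \<Rightarrow> nat" where
  "swap_col j k = (if k = j then b else if k = b then j else k)"

lemma measurable_swap_columns:
  assumes j: "j \<in> V - {a}"
  shows "(\<lambda>x. \<lambda>k\<in>V. x (swap_col j k)) \<in> measurable noise_row noise_row"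
  using j bV by (subst measurable_cong_sets[OF refl sets_noise_row], intro measurable_restrict measurable_coord(2))
    (auto simp: swap_col_def)

lemma distr_swap_columns:
  assumes j: "j \<in> V - {a}"
  shows "distr (noise_sample n) (noise_sample n) (\<lambda>U. \<lambda>i\<in>{1..n}. \<lambda>k\<in>V. U i (swap_col j k)) = noise_sample n"
proof -
  define r where "r = (\<lambda>x :: nat \<Rightarrow> real. \<lambda>k\<in>V. x (swap_col j k))"
  have same: "noise_law a \<sigma> (swap_col j k) = noise_law a \<sigma> k" for k
    using j ab by (auto simp: swap_col_def noise_law_def)
  have "distr noise_row noise_row r = noise_row"
  proof -
    have "inj_on (swap_col j) V" "swap_col j \<in> V \<rightarrow> V"
      using j bV by (auto simp: swap_col_def inj_on_def split: if_splits)
    from distr_PiM_reindex[where M = "noise_law a \<sigma>", OF prob_noise this] show ?thesis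
      unfolding same noise_row_def r_def .
  qed
  have rm: "r \<in> measurable noise_row noise_row"
    unfolding r_def by (rule measurable_swap_columns[OF j])
  have "distr (noise_sample n) (noise_sample n) (compose {1..n} r) = PiM {1..n} (\<lambda>_. distr noise_row noise_row r)"
    unfolding noise_sample_def by (rule distr_PiM_finite_prob_space') (auto simp: prob_noise_row rm)
  also have "\<dots> = noise_sample n" by (simp add: noise_sample_def \<open>distr noise_row noise_row r = noise_row\<close>)
  also have "compose {1..n} r = (\<lambda>U. \<lambda>i\<in>{1..n}. \<lambda>k\<in>V. U i (swap_col j k))"
    by (simp add: compose_def r_def fun_eq_iff)
  finally show ?thesis .
qed

text \<open>The sign \<open>\<epsilon>\<close> chooses between the largest and the smallest inner product with the noise column; the
  strict inequality makes the events for different columns disjoint.\<close>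

definition top_score :: "nat \<Rightarrow> real \<Rightarrow> nat \<Rightarrow> (nat \<Rightarrow> nat \<Rightarrow> real) set" where
  "top_score n \<epsilon> j = {U \<in> space (noise_sample n). \<forall>k\<in>V - {a} - {j}. \<epsilon> * cp n U k a < \<epsilon> * cp n U j a}"

lemma sets_top_score: "j \<in> V \<Longrightarrow> top_score n \<epsilon> j \<in> sets (noise_sample n)"
  unfolding top_score_def using finite_V aV by measurable

text \<open>The columns other than \<open>a\<close> are exchangeable.\<close>

lemma measure_top_score:
  assumes j: "j \<in> V - {a}"
  shows "measure (noise_sample n) (top_score n \<epsilon> j) = measure (noise_sample n) (top_score n \<epsilon> b)"
proof -
  let ?t = "\<lambda>U. \<lambda>i\<in>{1..n}. \<lambda>k\<in>V. U i (swap_col j k)"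
  have t: "?t \<in> measurable (noise_sample n) (noise_sample n)"
  proof -
    show ?thesis
      unfolding noise_sample_def using measurable_swap_columns[OF j]
      by (intro measurable_restrict measurable_compose[OF measurable_component_singleton])
  qed
  have cpt: "cp n (?t U) k a = cp n U (swap_col j k) a" if "k \<in> V" for U k
    unfolding ip_def using that aV j ab by (intro sum.cong) (auto simp: swap_col_def)
  have "measure (noise_sample n) (top_score n \<epsilon> j) = measure (distr (noise_sample n) (noise_sample n) ?t) (top_score n \<epsilon> j)"
    by (simp only: distr_swap_columns[OF j])
  also have "\<dots> = measure (noise_sample n) (?t -` top_score n \<epsilon> j \<inter> space (noise_sample n))"
    using t sets_top_score j by (intro measure_distr) auto
  also have "?t -` top_score n \<epsilon> j \<inter> space (noise_sample n) = top_score n \<epsilon> b"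
  proof -
    have "(\<forall>k\<in>V - {a} - {j}. \<epsilon> * cp n U (swap_col j k) a < \<epsilon> * cp n U (swap_col j j) a) \<longleftrightarrow>
        (\<forall>k\<in>V - {a} - {b}. \<epsilon> * cp n U k a < \<epsilon> * cp n U b a)" for U
    proof -
      have im: "swap_col j ` (V - {a} - {j}) = V - {a} - {b}" and jb: "swap_col j j = b"
        using j bV ab by (auto simp: swap_col_def image_iff)
      have "(\<forall>k\<in>V - {a} - {j}. \<epsilon> * cp n U (swap_col j k) a < \<epsilon> * cp n U (swap_col j j) a) \<longleftrightarrow>
          (\<forall>k\<in>swap_col j ` (V - {a} - {j}). \<epsilon> * cp n U k a < \<epsilon> * cp n U (swap_col j j) a)"
        by blast
      then show ?thesis unfolding im jb .
    qed
    note swapped = this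
    show ?thesis
    proof (rule Set.set_eqI)
      fix U
      have jV: "j \<in> V" using j by simp
      have "(\<forall>k\<in>V - {a} - {j}. \<epsilon> * cp n (?t U) k a < \<epsilon> * cp n (?t U) j a) \<longleftrightarrow>
          (\<forall>k\<in>V - {a} - {j}. \<epsilon> * cp n U (swap_col j k) a < \<epsilon> * cp n U (swap_col j j) a)"
        by (intro ball_cong refl) (simp only: cpt[OF jV] cpt[OF DiffD1[OF DiffD1]])
      also note swapped
      finally have "(\<forall>k\<in>V - {a} - {j}. \<epsilon> * cp n (?t U) k a < \<epsilon> * cp n (?t U) j a) \<longleftrightarrow>
          (\<forall>k\<in>V - {a} - {b}. \<epsilon> * cp n U k a < \<epsilon> * cp n U b a)" .
      then show "U \<in> ?t -` top_score n \<epsilon> j \<inter> space (noise_sample n) \<longleftrightarrow> U \<in> top_score n \<epsilon> b"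
        using measurable_space[OF t, of U] unfolding top_score_def by blast
    qed
  qed
  finally show ?thesis .
qed

text \<open>These disjoint events are equally likely for all columns, hence the reciprocal of their number.\<close>

lemma prob_top_score_le:
  "measure (noise_sample n) (top_score n \<epsilon> b) \<le> 1 / card (V - {a})"
proof -
  interpret prob_space "noise_sample n" by (rule prob_noise_sample)
  have dis: "disjoint_family_on (top_score n \<epsilon>) (V - {a})"
  proof (unfold disjoint_family_on_def, intro ballI impI)
    fix j k assume jk: "j \<in> V - {a}" "k \<in> V - {a}" "j \<noteq> k"
    { fix U assume "U \<in> top_score n \<epsilon> j" "U \<in> top_score n \<epsilon> k"
      then have "\<epsilon> * cp n U k a < \<epsilon> * cp n U j a" "\<epsilon> * cp n U j a < \<epsilon> * cp n U k a"
        using jk by (auto simp: top_score_def)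
      then have False by simp }
    then show "top_score n \<epsilon> j \<inter> top_score n \<epsilon> k = {}" by blast
  qed
  have "(\<Sum>j\<in>V - {a}. measure (noise_sample n) (top_score n \<epsilon> j)) = measure (noise_sample n) (\<Union>j\<in>V - {a}. top_score n \<epsilon> j)"
    using finite_V dis sets_top_score by (intro finite_measure_finite_Union[symmetric]) auto
  also have "\<dots> \<le> 1" by simp
  finally have "card (V - {a}) * measure (noise_sample n) (top_score n \<epsilon> b) \<le> 1"
    by (simp add: measure_top_score)
  moreover have "card (V - {a}) > 0" using finite_V bV ab by (auto simp: card_gt_0_iff)
  ultimately show ?thesis by (simp add: field_simps)
qed

lemma sets_good_design: "{U \<in> space (noise_sample n). good_design n (V - {a, b}) a b U} \<in> sets (noise_sample n)"
proof -
  have "Measurable.pred (noise_sample n) (good_design n (V - {a, b}) a b)"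
    unfolding good_design_def Let_def
  proof (intro pred_intros_logic pred_intros_finite pred_intros_imp')
    fix j k assume "j \<in> V - {a, b}" "k \<in> V - {a, b}"
    then have [measurable]: "j \<in> V" "k \<in> V" by auto
    note [measurable] = aV bV
    fix \<eta> \<epsilon> :: real
    show "Measurable.pred (noise_sample n) (\<lambda>U. (cp n U j a - \<eta> * cp n U b a) * (cp n U k b - \<epsilon> * cp n U b b) =
        (cp n U k a - \<epsilon> * cp n U b a) * (cp n U j b - \<eta> * cp n U b b))"
      by (rule pred_eq_real) measurable
  qed (use finite_V aV bV in \<open>auto intro!: borel_measurable_pred_less\<close>)
  then show ?thesis by (simp only: pred_def)
qed

lemma prob_not_good_design_le:
  assumes n: "n \<ge> 2"
  shows "measure (noise_sample n) {U \<in> space (noise_sample n). \<not> good_design n (V - {a, b}) a b U} \<le>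
    4 * card V * (1 / sqrt 2) ^ n + 2 / card (V - {a})"
proof -
  interpret prob_space "noise_sample n" by (rule prob_noise_sample)
  let ?K = "V - {a, b}"
  define E where "E = (\<lambda>\<eta> j k. {U \<in> space (noise_sample n). \<eta> * cp n U j k \<ge> cp n U k k})"
  define Bad where "Bad = (\<Union>k\<in>?K. (E 1 k b \<union> E (-1) k b) \<union> (E 1 b k \<union> E (-1) b k))"
  define Top where "Top = top_score n 1 b \<union> top_score n (-1) b"
  have E: "E \<eta> j k \<in> sets (noise_sample n)" if "j \<in> V" "k \<in> V" for \<eta> j k
    unfolding E_def using that by measurable
  have BadS: "Bad \<in> sets (noise_sample n)" unfolding Bad_def using E finite_V bV by (intro sets.finite_UN sets.Un) auto
  have TopS: "Top \<in> sets (noise_sample n)" unfolding Top_def using sets_top_score[OF bV] by blast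
  have Ele: "measure (noise_sample n) (E \<eta> j k) \<le> (1 / sqrt 2) ^ n"
    if "j \<in> V - {a}" "k \<in> V - {a}" "j \<noteq> k" "\<eta> \<in> {-1, 1}" for \<eta> j k
    unfolding E_def by (rule prob_correlated_le[OF that])
  have "measure (noise_sample n) Bad \<le> (\<Sum>k\<in>?K. measure (noise_sample n) ((E 1 k b \<union> E (-1) k b) \<union> (E 1 b k \<union> E (-1) b k)))"
    unfolding Bad_def using E finite_V bV by (intro measure_UNION_le) auto
  also have "\<dots> \<le> (\<Sum>k\<in>?K. 4 * (1 / sqrt 2) ^ n)"
  proof (rule sum_mono)
    fix k assume k: "k \<in> ?K"
    then have kV: "k \<in> V" "k \<in> V - {a}" "k \<noteq> b" and bVa: "b \<in> V - {a}" using bV ab by auto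
    have "measure (noise_sample n) ((E 1 k b \<union> E (-1) k b) \<union> (E 1 b k \<union> E (-1) b k)) \<le>
        (measure (noise_sample n) (E 1 k b) + measure (noise_sample n) (E (-1) k b)) + (measure (noise_sample n) (E 1 b k) + measure (noise_sample n) (E (-1) b k))"
      using E kV bV by (intro order_trans[OF measure_Un_le] add_mono) auto
    also have "\<dots> \<le> ((1 / sqrt 2) ^ n + (1 / sqrt 2) ^ n) + ((1 / sqrt 2) ^ n + (1 / sqrt 2) ^ n)"
      using kV bVa by (intro add_mono Ele) auto
    finally show "measure (noise_sample n) ((E 1 k b \<union> E (-1) k b) \<union> (E 1 b k \<union> E (-1) b k)) \<le> 4 * (1 / sqrt 2) ^ n"
      by simp
  qed
  also have "\<dots> \<le> 4 * card V * (1 / sqrt 2) ^ n"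
    using card_mono[OF finite_V, of ?K] by (simp add: mult_right_mono)
  finally have bad: "measure (noise_sample n) Bad \<le> 4 * card V * (1 / sqrt 2) ^ n" .
  have "measure (noise_sample n) Top \<le> measure (noise_sample n) (top_score n 1 b) + measure (noise_sample n) (top_score n (-1) b)"
    unfolding Top_def using sets_top_score[OF bV] by (intro measure_Un_le)
  also have "\<dots> \<le> 2 / card (V - {a})"
    using prob_top_score_le[of n 1] prob_top_score_le[of n "-1"] by simp
  finally have top: "measure (noise_sample n) Top \<le> 2 / card (V - {a})" .
  have fK: "finite ?K" using finite_V by simp
  have "AE U in noise_sample n. \<forall>k\<in>?K. cp n U k a \<noteq> cp n U b a"
    using fK n bV ab by (intro AE_finite_allI AE_no_score_tie) auto
  moreover have "AE U in noise_sample n. \<forall>j\<in>?K. \<forall>k\<in>?K. \<forall>\<eta>\<in>{-1,1}. \<forall>\<epsilon>\<in>{-1,1}. j \<noteq> k \<longrightarrow>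
      cp n U j b - \<eta> * cp n U b b \<noteq> 0 \<longrightarrow>
      (cp n U j a - \<eta> * cp n U b a) * (cp n U k b - \<epsilon> * cp n U b b) \<noteq>
      (cp n U k a - \<epsilon> * cp n U b a) * (cp n U j b - \<eta> * cp n U b b)"
    using fK AE_no_double_tie[OF n] by (intro AE_finite_allI) (auto simp del: Diff_iff)
  ultimately have "AE U in noise_sample n. U \<in> {U \<in> space (noise_sample n). \<not> good_design n ?K a b U} \<longrightarrow> U \<in> Bad \<union> Top"
  proof eventually_elim
    case (elim U)
    show ?case
    proof (rule impI, rule ccontr)
      assume U: "U \<in> {U \<in> space (noise_sample n). \<not> good_design n ?K a b U}" and nBT: "U \<notin> Bad \<union> Top"
      have g1: "\<bar>cp n U k b\<bar> < cp n U b b" "\<bar>cp n U k b\<bar> < cp n U k k" if "k \<in> ?K" for k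
      proof -
        have "U \<notin> E 1 k b" "U \<notin> E (-1) k b" "U \<notin> E 1 b k" "U \<notin> E (-1) b k"
          using nBT that unfolding Bad_def by blast+
        then show "\<bar>cp n U k b\<bar> < cp n U b b" "\<bar>cp n U k b\<bar> < cp n U k k"
          using U ip_commute[of n "\<lambda>i. U i b" "\<lambda>i. U i k"] by (simp_all add: E_def not_le abs_less_iff)
      qed
      have VK: "V - {a} - {b} = ?K" by auto
      have "U \<notin> top_score n 1 b" "U \<notin> top_score n (-1) b" "U \<in> space (noise_sample n)"
        using nBT U by (auto simp: Top_def)
      then have "\<exists>k\<in>?K. cp n U k a \<ge> cp n U b a" "\<exists>k\<in>?K. cp n U k a \<le> cp n U b a"
        unfolding top_score_def VK by (auto simp: not_less)
      then have ex: "\<exists>k\<in>?K. cp n U k a > cp n U b a" "\<exists>k\<in>?K. cp n U k a < cp n U b a"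
        using elim(1) by (metis order_le_less)+
      have nz: "cp n U j b - \<eta> * cp n U b b \<noteq> 0" if "j \<in> ?K" "\<eta> \<in> {-1,1}" for j \<eta>
        using g1(1)[OF that(1)] that(2) by auto
      have "good_design n ?K a b U"
        unfolding good_design_def Let_def
      proof (intro conjI ballI impI)
        fix j k \<eta> \<epsilon> assume h: "j \<in> ?K" "k \<in> ?K" "j \<noteq> k" "\<eta> \<in> {-1,1::real}" "\<epsilon> \<in> {-1,1::real}"
        show "(cp n U j a - \<eta> * cp n U b a) * (cp n U k b - \<epsilon> * cp n U b b) \<noteq>
            (cp n U k a - \<epsilon> * cp n U b a) * (cp n U j b - \<eta> * cp n U b b)"
          by (rule elim(2)[rule_format, OF h(1,2,4,5,3) nz[OF h(1,4)]])
      qed (use g1 ex in \<open>simp_all only:\<close>)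
      then show False using U by simp
    qed
  qed
  then have "measure (noise_sample n) {U \<in> space (noise_sample n). \<not> good_design n ?K a b U} \<le> measure (noise_sample n) (Bad \<union> Top)"
    using BadS TopS by (intro finite_measure_mono_AE) auto
  also have "\<dots> \<le> measure (noise_sample n) Bad + measure (noise_sample n) Top"
    using BadS TopS by (intro measure_Un_le)
  finally show ?thesis using bad top by linarith
qed

end

section \<open>From independent noise to the sample\<close>

lemma mvn_sample_prob_space:
  assumes "mvn_sample M n p S X" "n \<ge> 1"
  shows "prob_space M" and "prob_space (mvn p S)"
    and "\<And>i. i \<in> {1..n} \<Longrightarrow> (\<lambda>\<omega>. restrict (X \<omega> i) {1..p}) \<in> measurable M (PiM {1..p} (\<lambda>_. borel))"
proof -
  show M: "prob_space M" using assms by (simp add: mvn_sample_def)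
  show rv: "(\<lambda>\<omega>. restrict (X \<omega> i) {1..p}) \<in> measurable M (PiM {1..p} (\<lambda>_. borel))" if "i \<in> {1..n}" for i
  proof -
    have "prob_space.indep_vars M (\<lambda>_. PiM {1..p} (\<lambda>_. borel)) (\<lambda>i \<omega>. restrict (X \<omega> i) {1..p}) {1..n}"
      using assms(1) unfolding mvn_sample_def by blast
    then show ?thesis using that unfolding prob_space.indep_vars_def[OF M] by blast
  qed
  have 1: "1 \<in> {1..n}" using assms(2) by simp
  have sets_eq: "sets (mvn p S) = sets (PiM {1..p} (\<lambda>_. borel :: real measure))"
    unfolding mvn_def sets_density by (rule sets_PiM_cong) auto
  have "(\<lambda>\<omega>. restrict (X \<omega> 1) {1..p}) \<in> measurable M (mvn p S)"
    using rv[OF 1] by (simp only: measurable_cong_sets[OF refl sets_eq])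
  then have "prob_space (distr M (mvn p S) (\<lambda>\<omega>. restrict (X \<omega> 1) {1..p}))"
    using M by (intro prob_space.prob_space_distr)
  moreover have "distr M (mvn p S) (\<lambda>\<omega>. restrict (X \<omega> 1) {1..p}) = mvn p S"
    using assms(1) 1 unfolding mvn_sample_def by blast
  ultimately show "prob_space (mvn p S)" by simp
qed

lemma good_design_cong:
  assumes "\<And>i k. i \<in> {1..n} \<Longrightarrow> k \<in> insert a (insert b K) \<Longrightarrow> U i k = U' i k"
  shows "good_design n K a b U = good_design n K a b U'"
proof -
  have "ip n (\<lambda>i. U i j) (\<lambda>i. U i k) = ip n (\<lambda>i. U' i j) (\<lambda>i. U' i k)"
    if "j \<in> insert a (insert b K)" "k \<in> insert a (insert b K)" for j k
    unfolding ip_def using assms that by (intro sum.cong) auto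
  then show ?thesis
    unfolding good_design_def Let_def by (simp cong: ball_cong bex_cong)
qed

text \<open>Undoing the shear row by row turns the sample into independent rows of noise variables, so that the joint law
  of all entries is the product law for which the bound has been computed.\<close>

lemma prob_not_good_sample_le:
  assumes n: "n \<ge> 2" and ab: "a \<in> {1..p}" "b \<in> {1..p}" "a \<noteq> b" and s: "0 < s" "s < 1"
    and S: "\<And>i j. i \<in> {1..p} \<Longrightarrow> j \<in> {1..p} \<Longrightarrow> S i j = pair_mat a b 1 s i j"
    and sample: "mvn_sample M n p S X"
  defines "G \<equiv> {\<omega> \<in> space M. good_design n ({1..p} - {a, b}) a b (\<lambda>i. (X \<omega> i)(a := X \<omega> i a - s * X \<omega> i b))}"
  shows "G \<in> sets M" and "measure M G \<ge> 1 - (4 * real p * (1 / sqrt 2) ^ n + 2 / real (p - 1))"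
proof -
  have n1: "n \<ge> 1" using n by simp
  note pr = mvn_sample_prob_space[OF sample n1]
  note mvn_eq = mvn_eq_distr_noise[OF ab s S pr(2)]
  interpret M: prob_space M by (rule pr(1))
  interpret G: gaussian_pair "{1..p}" a b s
    by unfold_locales (use ab s in auto)
  interpret noise_sample: prob_space "G.noise_sample n" by (rule G.prob_noise_sample)
  have observation: "mvn p S = G.observation"
    unfolding G.observation_def G.noise_row_def G.\<sigma>_def G.shear_def[abs_def] by (rule mvn_eq)
  define row where "row = (\<lambda>i \<omega>. restrict (X \<omega> i) {1..p})"
  define g where "g = (\<lambda>x :: nat \<Rightarrow> real. x(a := x a - s * x b))"
  have row: "row i \<in> measurable M (PiM {1..p} (\<lambda>_. borel))" if "i \<in> {1..n}" for i
    unfolding row_def by (rule pr(3)[OF that])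
  have gm: "g \<in> measurable (PiM {1..p} (\<lambda>_. borel)) G.noise_row"
    using measurable_add_multiple[OF ab(1,2), of "- s"] unfolding g_def
    by (subst measurable_cong_sets[OF refl G.sets_noise_row]) simp
  have gN: "g \<in> measurable G.observation G.noise_row" using gm by (simp only: measurable_cong_sets[OF G.sets_observation refl])
  have rowN: "row i \<in> measurable M G.observation" if "i \<in> {1..n}" for i
    using row[OF that] by (simp only: measurable_cong_sets[OF refl G.sets_observation])
  have law: "distr M G.noise_row (g \<circ> row i) = G.noise_row" if i: "i \<in> {1..n}" for i
  proof -
    have "distr M G.observation (row i) = G.observation"
      using sample i unfolding mvn_sample_def observation row_def by blast
    then show ?thesis
      using distr_distr[OF gN rowN[OF i]] G.distr_observation_noise by (simp only: g_def)
  qed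
  have "M.indep_vars (\<lambda>_. PiM {1..p} (\<lambda>_. borel)) row {1..n}"
    using sample unfolding mvn_sample_def row_def by blast
  then have ind: "M.indep_vars (\<lambda>_. G.noise_row) (\<lambda>i. g \<circ> row i) {1..n}"
    by (rule M.indep_vars_compose) (rule gm)
  have rv: "g \<circ> row i \<in> measurable M G.noise_row" if "i \<in> {1..n}" for i
    using row[OF that] gm by (rule measurable_comp)
  define D where "D = (\<lambda>\<omega>. \<lambda>i\<in>{1..n}. (g \<circ> row i) \<omega>)"
  have "distr M (PiM {1..n} (\<lambda>_. G.noise_row)) D = PiM {1..n} (\<lambda>i. distr M G.noise_row (g \<circ> row i))"
    unfolding D_def using ind n1
    by (subst (asm) M.indep_vars_iff_distr_eq_PiM'[OF _ rv]) auto
  also have "\<dots> = PiM {1..n} (\<lambda>_. G.noise_row)" by (intro PiM_cong refl law)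
  finally have distr_D: "distr M (G.noise_sample n) D = G.noise_sample n" by (simp only: G.noise_sample_def)
  have Dm: "D \<in> measurable M (G.noise_sample n)"
    unfolding D_def G.noise_sample_def by (intro measurable_restrict rv)
  let ?A = "{U \<in> space (G.noise_sample n). good_design n ({1..p} - {a, b}) a b U}"
  have A: "?A \<in> sets (G.noise_sample n)" by (rule G.sets_good_design)
  have GD: "G = D -` ?A \<inter> space M"
  proof -
    have "good_design n ({1..p} - {a, b}) a b (D \<omega>) =
        good_design n ({1..p} - {a, b}) a b (\<lambda>i. (X \<omega> i)(a := X \<omega> i a - s * X \<omega> i b))" for \<omega>
      by (rule good_design_cong) (use ab in \<open>auto simp: D_def g_def row_def\<close>)
    then show ?thesis unfolding G_def using measurable_space[OF Dm] by blast
  qed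
  show "G \<in> sets M" unfolding GD using Dm A by (rule measurable_sets)
  have "measure M G = measure (G.noise_sample n) ?A"
    unfolding GD measure_distr[OF Dm A, symmetric] distr_D ..
  also have "\<dots> = 1 - measure (G.noise_sample n) {U \<in> space (G.noise_sample n). \<not> good_design n ({1..p} - {a, b}) a b U}"
  proof -
    have "measure (G.noise_sample n) (space (G.noise_sample n) - ?A) = 1 - measure (G.noise_sample n) ?A" by (rule noise_sample.prob_compl[OF A])
    moreover have "space (G.noise_sample n) - ?A = {U \<in> space (G.noise_sample n). \<not> good_design n ({1..p} - {a, b}) a b U}" by blast
    ultimately show ?thesis by simp
  qed
  also have "\<dots> \<ge> 1 - (4 * real p * (1 / sqrt 2) ^ n + 2 / real (p - 1))"
    using G.prob_not_good_design_le[OF n] ab(1) by simp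
  finally show "measure M G \<ge> 1 - (4 * real p * (1 / sqrt 2) ^ n + 2 / real (p - 1))" .
qed

lemma failure_bound_tendsto_zero:
  fixes p :: "nat \<Rightarrow> nat"
  assumes p_lim: "filterlim p at_top sequentially"
    and p_growth: "(\<lambda>n. real (p n)) \<in> o(\<lambda>n. real n powr \<gamma>)"
  shows "(\<lambda>n. 4 * real (p n) * (1 / sqrt 2) ^ n + 2 / real (p n - 1)) \<longlonglongrightarrow> 0"
proof -
  have lim: "(\<lambda>n. real n powr \<gamma> * (1 / sqrt 2) ^ n) \<longlonglongrightarrow> 0" by real_asymp
  have "eventually (\<lambda>n. norm (real (p n)) \<le> 1 * norm (real n powr \<gamma>)) sequentially"
    using landau_o.smallD[OF p_growth, of 1] by simp
  then have "eventually (\<lambda>n. norm (real (p n) * (1 / sqrt 2) ^ n) \<le> real n powr \<gamma> * (1 / sqrt 2) ^ n) sequentially"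
    by eventually_elim (simp add: mult_right_mono)
  then have "(\<lambda>n. real (p n) * (1 / sqrt 2) ^ n) \<longlonglongrightarrow> 0"
    using lim by (rule Lim_null_comparison)
  from tendsto_mult_left[OF this, of 4]
  have 1: "(\<lambda>n. 4 * real (p n) * (1 / sqrt 2) ^ n) \<longlonglongrightarrow> 0" by (simp add: mult.assoc)
  have "(\<lambda>m. 2 / real (m - 1)) \<longlonglongrightarrow> 0" by real_asymp
  then have "(\<lambda>n. 2 / real (p n - 1)) \<longlonglongrightarrow> 0" using p_lim by (rule filterlim_compose)
  from tendsto_add[OF 1 this] show ?thesis by simp
qed

theorem proposition1:
  fixes p a b :: "nat \<Rightarrow> nat"
    and s \<gamma> :: real
    and \<Sigma> :: "nat \<Rightarrow> nat \<Rightarrow> nat \<Rightarrow> real"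
    and M :: "nat \<Rightarrow> 'w measure"
    and X :: "nat \<Rightarrow> 'w \<Rightarrow> nat \<Rightarrow> nat \<Rightarrow> real"
    and \<theta> :: "nat \<Rightarrow> 'w \<Rightarrow> real \<Rightarrow> nat \<Rightarrow> real"
    and lam :: "nat \<Rightarrow> 'w \<Rightarrow> real"
  assumes p_lim: "filterlim p at_top sequentially"
    and gamma: "\<gamma> > 0"
    and p_growth: "(\<lambda>n. real (p n)) \<in> o(\<lambda>n. real n powr \<gamma>)"
    and s: "0 < s" "s < 1"
    and ab: "\<And>n. n \<ge> 1 \<Longrightarrow> a n \<in> {1..p n} \<and> b n \<in> {1..p n} \<and> a n \<noteq> b n"
    and Sigma: "\<And>n i j. n \<ge> 1 \<Longrightarrow> i \<in> {1..p n} \<Longrightarrow> j \<in> {1..p n} \<Longrightarrow>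
        \<Sigma> n i j = (if i = j then 1 else if {i, j} = {a n, b n} then s else 0)"
    and sample: "\<And>n. n \<ge> 1 \<Longrightarrow> mvn_sample (M n) n (p n) (\<Sigma> n) (X n)"
    and lasso: "\<And>n. n \<ge> 1 \<Longrightarrow> AE \<omega> in M n. \<forall>l\<ge>0.
        is_lasso n (p n) (X n \<omega>) (a n) l (\<theta> n \<omega> l)"
    and lam_oracle: "\<And>n. n \<ge> 1 \<Longrightarrow> AE \<omega> in M n.
        is_oracle_penalty (p n) (\<Sigma> n) (a n) (\<theta> n \<omega>) (lam n \<omega>)"
    and event: "\<And>n. n \<ge> 1 \<Longrightarrow>
        {\<omega> \<in> space (M n). selected_neighborhood (p n) (\<theta> n \<omega> (lam n \<omega>))
            \<noteq> neighborhood (p n) (\<Sigma> n) (a n)} \<in> sets (M n)"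
  shows "(\<lambda>n. measure (M n)
        {\<omega> \<in> space (M n). selected_neighborhood (p n) (\<theta> n \<omega> (lam n \<omega>))
            \<noteq> neighborhood (p n) (\<Sigma> n) (a n)}) \<longlonglongrightarrow> 1"
proof (rule tendsto_sandwich)
  let ?E = "\<lambda>n. {\<omega> \<in> space (M n). selected_neighborhood (p n) (\<theta> n \<omega> (lam n \<omega>))
            \<noteq> neighborhood (p n) (\<Sigma> n) (a n)}"
  show "(\<lambda>n. 1 - (4 * real (p n) * (1 / sqrt 2) ^ n + 2 / real (p n - 1))) \<longlonglongrightarrow> 1"
    using tendsto_diff[OF tendsto_const failure_bound_tendsto_zero[OF p_lim p_growth], of 1] by simp
  show "eventually (\<lambda>n. measure (M n) (?E n) \<le> 1) sequentially"
    using eventually_ge_at_top[of 1]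
  proof eventually_elim
    case (elim n)
    interpret prob_space "M n" by (rule mvn_sample_prob_space(1)[OF sample[OF elim] elim])
    show ?case by simp
  qed
  show "eventually (\<lambda>n. 1 - (4 * real (p n) * (1 / sqrt 2) ^ n + 2 / real (p n - 1)) \<le> measure (M n) (?E n)) sequentially"
    using eventually_ge_at_top[of 2]
  proof eventually_elim
    case (elim n)
    then have n: "n \<ge> 1" by simp
    have abn: "a n \<in> {1..p n}" "b n \<in> {1..p n}" "a n \<noteq> b n" using ab[OF n] by auto
    have S: "\<Sigma> n i j = pair_mat (a n) (b n) 1 s i j" if "i \<in> {1..p n}" "j \<in> {1..p n}" for i j
      unfolding Sigma[OF n that] by (simp add: pair_mat_def)
    note pr = mvn_sample_prob_space[OF sample[OF n] n]
    interpret prob_space "M n" by (rule pr(1))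
    have nb: "neighborhood (p n) (\<Sigma> n) (a n) = {b n}"
      by (rule neighborhood_pair[OF abn s S pr(2)])
    let ?G = "{\<omega> \<in> space (M n). good_design n ({1..p n} - {a n, b n}) (a n) (b n)
        (\<lambda>i. (X n \<omega> i)(a n := X n \<omega> i (a n) - s * X n \<omega> i (b n)))}"
    have "1 - (4 * real (p n) * (1 / sqrt 2) ^ n + 2 / real (p n - 1)) \<le> measure (M n) ?G"
      by (rule prob_not_good_sample_le(2)[OF elim abn s S sample[OF n]])
    also have "\<dots> \<le> measure (M n) (?E n)"
    proof (rule finite_measure_mono_AE)
      show "AE \<omega> in M n. \<omega> \<in> ?G \<longrightarrow> \<omega> \<in> ?E n"
        using lasso[OF n] lam_oracle[OF n]
      proof eventually_elim
        case (elim \<omega>)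
        show ?case
        proof
          assume \<omega>: "\<omega> \<in> ?G"
          have "selected_neighborhood (p n) (\<theta> n \<omega> (lam n \<omega>)) \<noteq> {b n}"
          proof (rule oracle_not_single[OF n _ abn _ _ elim(2)])
            show "0 \<le> s" using s by simp
            show "is_lasso n (p n) (X n \<omega>) (a n) l (\<theta> n \<omega> l)" if "l \<ge> 0" for l
              using elim(1) that by blast
            show "prediction_risk (p n) (\<Sigma> n) (a n) \<theta> =
                (1 - s\<^sup>2) + (\<theta> (b n) - s)\<^sup>2 + (\<Sum>k\<in>{1..p n} - {a n, b n}. (\<theta> k)\<^sup>2)"
              if "\<theta> (a n) = 0" for \<theta>
              by (rule prediction_risk_pair[where \<theta> = \<theta>, OF abn s S pr(2) that])
            show "good_design n ({1..p n} - {a n, b n}) (a n) (b n)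
                (\<lambda>i. (X n \<omega> i)(a n := X n \<omega> i (a n) - s * X n \<omega> i (b n)))"
              using \<omega> by blast
          qed
          then show "\<omega> \<in> ?E n" using \<omega> nb by simp
        qed
      qed
      show "?E n \<in> sets (M n)" by (rule event[OF n])
    qed
    finally show ?case .
  qed
qed simp

end
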